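(* Let $f:\mathbb{R}^d\to\mathbb{R}$ be differentiable with minimum value $f^\star=\min_{x} f(x)$, and $L$-smooth: $\|\nabla f(x)-\nabla f(y)\|\le L\|x-y\|$ for all $x,y\in\mathbb{R}^d$. Let $M,\sigma^2\ge0$, and let $\mathcal C$ be a $\delta$-approximate compressor, $\delta>0$ (see context). Let $\{x_t\}_{t\ge0}$ be the iterates of error-compensated SGD with constant stepsize $\gamma$ and starting point $x_0\in\mathbb{R}^d$: $e_0=0$ and, for $t\ge0$, $$v_t=\mathcal C(e_t+\gamma g_t),\qquad x_{t+1}=x_t-v_t,\qquad e_{t+1}=e_t+\gamma g_t-v_t,\qquad g_t=\nabla f(x_t)+\xi_t,$$ where the noise $\xi_t$ is $(M,\sigma^2)$-bounded (see context). Let $T\ge1$ be an integer. Then: (1) If $f$ is $\mu$-quasi-convex with respect to $x^\star$ with $\mu>0$, there exists a stepsize $\gamma\le\frac{1}{10L(2/\delta+M)}$ (chosen as in rule A of the context) such that $$\mathbb{E} f(x^{\rm out})-f^\star=\tilde{\mathcal O}\left(L(1/\delta+M)\|x_0-x^\star\|^2\exp\left[-\frac{\mu T}{10L(2/\delta+M)}\right]+\frac{\sigma^2}{\mu T}\right),$$ where $x^{\rm out}\in\{x_t\}_{t=0}^{T-1}$ is chosen to be $x_t$ with probability proportional to $(1-\mu\gamma/2)^{-t}$. (2) If $f$ is $\mu$-quasi-convex with respect to $x^\star$ with $\mu=0$, there exists a stepsize $\gamma\le\frac{1}{10L(2/\delta+M)}$ (chosen as in rule B of the context) such that $$\mathbb{E}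 f(x^{\rm out})-f^\star=\mathcal O\left(\frac{L(1/\delta+M)\|x_0-x^\star\|^2}{T}+\frac{\sigma\|x_0-x^\star\|}{\sqrt T}\right),$$ where $x^{\rm out}$ is chosen uniformly at random from $\{x_t\}_{t=0}^{T-1}$. (3) If $f$ is an arbitrary (possibly non-convex) such function, there exists a stepsize $\gamma\le\frac{1}{10L(1/\delta+M)}$ (chosen as in rule B of the context) such that $$\mathbb{E}\|\nabla f(x^{\rm out})\|^2=\mathcal O\left(\frac{L(1/\delta+M)(f(x_0)-f^\star)}{T}+\sigma\sqrt{\frac{L(f(x_0)-f^\star)}{T}}\right),$$ where $x^{\rm out}$ is chosen uniformly at random from $\{x_t\}_{t=0}^{T-1}$.
   Context: $\delta$-approximate compressor: a random operator $\mathcal C:\mathbb{R}^d\to\mathbb{R}^d$ with $\mathbb{E}_{\mathcal C}\|x-\mathcal C(x)\|^2\le(1-\delta)\|x\|^2$ for all $x\in\mathbb{R}^d$, the expectation being over the internal randomness of $\mathcal C$, which is drawn afresh at each application. $\mu$-quasi-convexity with respect to $x^\star$ ($\mu\ge0$): $f(x)-f^\star+\frac{\mu}{2}\|x-x^\star\|^2\le\langle\nabla f(x),x-x^\star\rangle$ for all $x\in\mathbb{R}^d$ (this forces $x^\star$ to be a minimizer of $f$). $(M,\sigma^2)$-bounded noise: in each gradient $g=\nabla f(x)+\xi$ the noise $\xi$ is conditionally independent (given the query point $x$, independent of the past of the algorithm), with $\mathbb{E}[\xi\mid x]=0$ and $\mathbb{E}[\|\xi\|^2\mid x]\le M\|\nabla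 f(x)\|^2+\sigma^2$. Stepsize rules, where $1/d$ denotes the upper bound on $\gamma$ stated in the respective item. Rule A: $\gamma\le 1/d$ is tuned, depending on the problem parameters and $T$, so as to make $\frac{r_0}{\gamma}\exp[-a\gamma T]+c\gamma$ small, where $a=\mu/2$, $r_0=\|x_0-x^\star\|^2$ and $c$ is a constant multiple of $\sigma^2$. Rule B: $\gamma=\sqrt{r_0/(cT)}$ if this is at most $1/d$, and $\gamma=1/d$ otherwise, where in (2) $r_0=\|x_0-x^\star\|^2$ and $c$ is a constant multiple of $\sigma^2$, and in (3) $r_0$ is a constant multiple of $f(x_0)-f^\star$ and $c$ a constant multiple of $L\sigma^2$. Expectations are over all randomness, including the choice of $x^{\rm out}$. $\mathcal O(\cdot)$ hides constant factors; $\tilde{\mathcal O}(\cdot)$ hides constants and factors polylogarithmic in the problem parameters.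
   Formalization: In (1) the exponent is -μT/(20L(2/δ+M)), half the printed rate: the printed one fails for f=μx²/2, L=μ, C=id, M=σ=0, since x^out=x_0 has probability at least (39/40)^{T-1}/T. *)

theory Defs
  imports "HOL-Probability.Probability"
begin

definition quasi_convex ::
  "real \<Rightarrow> ('a::euclidean_space \<Rightarrow> real) \<Rightarrow> ('a \<Rightarrow> 'a) \<Rightarrow> real \<Rightarrow> 'a \<Rightarrow> bool" where
  "quasi_convex \<mu> f grad fmin xs \<longleftrightarrow>
     (\<forall>x. f x - fmin + \<mu> / 2 * (norm (x - xs))\<^sup>2 \<le> grad x \<bullet> (x - xs))"

text \<open>A random operator is a jointly measurable map \<open>C\<close> of the input and of a seed with law \<open>S\<close>;
  one application of the operator to \<open>x\<close> is \<open>C x s\<close> for a freshly drawn seed \<open>s\<close>.\<close>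

definition approx_compressor ::
  "real \<Rightarrow> 's measure \<Rightarrow> ('a::euclidean_space \<Rightarrow> 's \<Rightarrow> 'a) \<Rightarrow> bool" where
  "approx_compressor \<delta> S C \<longleftrightarrow>
     prob_space S \<and>
     (\<lambda>(x, s). C x s) \<in> borel_measurable (borel \<Otimes>\<^sub>M S) \<and>
     (\<forall>x. integrable S (\<lambda>s. (norm (x - C x s))\<^sup>2) \<and>
          (\<integral>s. (norm (x - C x s))\<^sup>2 \<partial>S) \<le> (1 - \<delta>) * (norm x)\<^sup>2)"

definition gen_sets :: "'w measure \<Rightarrow> 'b measure \<Rightarrow> ('w \<Rightarrow> 'b) \<Rightarrow> 'w set set" where
  "gen_sets P N X = {X -` A \<inter> space P | A. A \<in> sets N}"

text \<open>\<open>history P S \<xi> s m n\<close> is the \<open>\<sigma>\<close>-algebra generated by the first \<open>m\<close> noise vectors and the first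
  \<open>n\<close> seeds. As \<open>x\<^sub>0\<close> and \<open>e\<^sub>0\<close> are deterministic, \<open>m = n = t\<close> gives the past of the algorithm when the
  gradient at \<open>x\<^sub>t\<close> is queried, and \<open>m = t + 1\<close>, \<open>n = t\<close> the past when the compressor is applied in
  step \<open>t\<close>.\<close>

definition history ::
  "'w measure \<Rightarrow> 's measure \<Rightarrow> (nat \<Rightarrow> 'w \<Rightarrow> 'a::euclidean_space) \<Rightarrow> (nat \<Rightarrow> 'w \<Rightarrow> 's)
     \<Rightarrow> nat \<Rightarrow> nat \<Rightarrow> 'w measure" where
  "history P S \<xi> s m n =
     sigma (space P) ((\<Union>i<m. gen_sets P borel (\<xi> i)) \<union> (\<Union>i<n. gen_sets P S (s i)))"

definition cond_indep_sets :: "'w measure \<Rightarrow> 'w measure \<Rightarrow> 'w set set \<Rightarrow> 'w set set \<Rightarrow> bool" where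
  "cond_indep_sets P F \<A> \<B> \<longleftrightarrow>
     (\<forall>A\<in>\<A>. \<forall>B\<in>\<B>. AE \<omega> in P.
        real_cond_exp P F (indicator (A \<inter> B)) \<omega> =
        real_cond_exp P F (indicator A) \<omega> * real_cond_exp P F (indicator B) \<omega>)"

text \<open>\<open>F\<close> is the past of the algorithm and \<open>x\<close> the query point. The second moment is conditioned in
  \<open>[0, \<infinity>]\<close>, so its bound is meaningful without an integrability assumption.\<close>

definition bounded_noise ::
  "real \<Rightarrow> real \<Rightarrow> ('a::euclidean_space \<Rightarrow> 'a) \<Rightarrow> 'w measure \<Rightarrow> 'w measure
     \<Rightarrow> ('w \<Rightarrow> 'a) \<Rightarrow> ('w \<Rightarrow> 'a) \<Rightarrow> bool" where
  "bounded_noise M \<sigma> grad P F x \<xi> \<longleftrightarrow>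
     \<xi> \<in> borel_measurable P \<and>
     cond_indep_sets P (vimage_algebra (space P) x borel) (gen_sets P borel \<xi>) (sets F) \<and>
     (\<forall>b\<in>Basis. AE \<omega> in P.
        real_cond_exp P (vimage_algebra (space P) x borel) (\<lambda>\<omega>. \<xi> \<omega> \<bullet> b) \<omega> = 0) \<and>
     (AE \<omega> in P.
        nn_cond_exp P (vimage_algebra (space P) x borel) (\<lambda>\<omega>. ennreal ((norm (\<xi> \<omega>))\<^sup>2)) \<omega>
          \<le> ennreal (M * (norm (grad (x \<omega>)))\<^sup>2 + \<sigma>\<^sup>2))"

definition fresh_seed ::
  "'w measure \<Rightarrow> 's measure \<Rightarrow> 'w measure \<Rightarrow> ('w \<Rightarrow> 's) \<Rightarrow> bool" where
  "fresh_seed P S F s \<longleftrightarrow>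
     s \<in> measurable P S \<and> distr P S s = S \<and>
     prob_space.indep_set P (sets F) (gen_sets P S s)"

text \<open>A run of error-compensated SGD with stepsize \<open>\<gamma>\<close> on the probability space \<open>P\<close>. The law of the
  noise depends on the query points and hence on \<open>\<gamma>\<close>.\<close>

definition ec_sgd_run ::
  "real \<Rightarrow> real \<Rightarrow> ('a::euclidean_space \<Rightarrow> 'a) \<Rightarrow> 's measure \<Rightarrow> ('a \<Rightarrow> 's \<Rightarrow> 'a) \<Rightarrow> 'a \<Rightarrow> real
     \<Rightarrow> 'w measure \<Rightarrow> (nat \<Rightarrow> 'w \<Rightarrow> 'a) \<Rightarrow> (nat \<Rightarrow> 'w \<Rightarrow> 's)
     \<Rightarrow> (nat \<Rightarrow> 'w \<Rightarrow> 'a) \<Rightarrow> (nat \<Rightarrow> 'w \<Rightarrow> 'a) \<Rightarrow> (nat \<Rightarrow> 'w \<Rightarrow> 'a) \<Rightarrow> (nat \<Rightarrow> 'w \<Rightarrow> 'a) \<Rightarrow> bool" where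
  "ec_sgd_run M \<sigma> grad S C x0 \<gamma> P \<xi> s x e g v \<longleftrightarrow>
     prob_space P \<and>
     (\<forall>\<omega>\<in>space P. x 0 \<omega> = x0 \<and> e 0 \<omega> = 0) \<and>
     (\<forall>t. \<forall>\<omega>\<in>space P.
        g t \<omega> = grad (x t \<omega>) + \<xi> t \<omega> \<and>
        v t \<omega> = C (e t \<omega> + \<gamma> *\<^sub>R g t \<omega>) (s t \<omega>) \<and>
        x (Suc t) \<omega> = x t \<omega> - v t \<omega> \<and>
        e (Suc t) \<omega> = e t \<omega> + \<gamma> *\<^sub>R g t \<omega> - v t \<omega>) \<and>
     (\<forall>t. bounded_noise M \<sigma> grad P (history P S \<xi> s t t) (x t) (\<xi> t)) \<and>
     (\<forall>t. fresh_seed P S (history P S \<xi> s (Suc t) t) (s t))"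

text \<open>The output index is drawn from \<open>p\<close> independently of the run, and \<open>h t \<omega>\<close> is the quantity
  of interest evaluated at \<open>x\<^sub>t\<close>. The predicate includes integrability, because a non-integrable
  function has Bochner integral \<open>0\<close>.\<close>

definition expectation_out_le ::
  "nat pmf \<Rightarrow> 'w measure \<Rightarrow> (nat \<Rightarrow> 'w \<Rightarrow> real) \<Rightarrow> real \<Rightarrow> bool" where
  "expectation_out_le p P h B \<longleftrightarrow>
     integrable (measure_pmf p \<Otimes>\<^sub>M P) (\<lambda>(t, \<omega>). h t \<omega>) \<and>
     (\<integral>(t, \<omega>). h t \<omega> \<partial>(measure_pmf p \<Otimes>\<^sub>M P)) \<le> B"

definition geometric_index :: "real \<Rightarrow> nat \<Rightarrow> nat pmf" where
  "geometric_index q T =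
     embed_pmf (\<lambda>t. if t < T then (1 / q ^ t) / (\<Sum>i<T. 1 / q ^ i) else 0)"

abbreviation uniform_index :: "nat \<Rightarrow> nat pmf" where
  "uniform_index T \<equiv> pmf_of_set {..<T}"

text \<open>The constant hidden in \<open>O\<close>. An existential quantifier inside a theorem would let it depend on
  the type of the ambient space, hence on the dimension, and on the types of the probability spaces;
  a fixed number is uniform in everything. Its value is not optimized.\<close>

definition O_const :: real where
  "O_const = 1000"

text \<open>The logarithmic factor arising when \<open>r\<^sub>0 / \<gamma> * exp (- a * \<gamma> * T) + c * \<gamma>\<close> is tuned over \<open>\<gamma>\<close>.
  For \<open>c = 0\<close> the quotient is \<open>0\<close> by convention and the value is \<open>ln 2\<close>.\<close>

definition tuning_log :: "real \<Rightarrow> real \<Rightarrow> real \<Rightarrow> nat \<Rightarrow> real" where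
  "tuning_log a c r0 T = ln (max 2 (a\<^sup>2 * r0 * (real T)\<^sup>2 / c))"

text \<open>Stepsizes below the upper bound \<open>1 / D\<close>. The case \<open>c = 0\<close> is where the second argument of the
  minimum, respectively the square root, stands for \<open>\<infinity>\<close>.\<close>

definition stepsize_A :: "real \<Rightarrow> real \<Rightarrow> real \<Rightarrow> real \<Rightarrow> nat \<Rightarrow> real" where
  "stepsize_A a c r0 D T =
     (if c = 0 then 1 / D else min (1 / D) (tuning_log a c r0 T / (a * real T)))"

definition stepsize_B :: "real \<Rightarrow> real \<Rightarrow> real \<Rightarrow> nat \<Rightarrow> real" where
  "stepsize_B c r0 D T =
     (if c \<noteq> 0 \<and> sqrt (r0 / (c * real T)) \<le> 1 / D then sqrt (r0 / (c * real T)) else 1 / D)"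

text \<open>In which sense \<^const>\<open>stepsize_A\<close> makes \<open>r\<^sub>0 / \<gamma> * exp (- a * \<gamma> * T) + c * \<gamma>\<close> small. In the
  strongly quasi-convex case \<open>a = \<mu> / 2\<close>, so the exponential is \<open>exp (- (\<mu> / 2) * T / D)\<close>. The factor
  \<open>1 / 2\<close> cannot be dropped: for \<open>f x = \<mu> / 2 * x\<^sup>2\<close> on the line with \<open>L = \<mu>\<close>, no noise and no compression,
  the output is \<open>x\<^sub>0\<close> with probability at least \<open>(1 - \<mu> / (2 * D)) ^ (T - 1) / T\<close>, where
  \<open>\<mu> / D = 1 / 20\<close>, and this is not \<open>O (T ^ k * exp (- T / 20))\<close> for any \<open>k\<close>.\<close>

lemma stepsize_A_tuned:
  fixes a c r0 D :: real and T :: nat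
  assumes "a > 0" "c \<ge> 0" "r0 \<ge> 0" "D > 0" "T \<ge> 1"
  defines "\<gamma> \<equiv> stepsize_A a c r0 D T"
  shows "0 < \<gamma>" "\<gamma> \<le> 1 / D"
    "r0 / \<gamma> * exp (- a * \<gamma> * T) + c * \<gamma>
       \<le> 5 * tuning_log a c r0 T * (D * r0 * exp (- a * T / D) + c / (a * T))"
proof -
  define l where "l = tuning_log a c r0 T"
  define y where "y = a\<^sup>2 * r0 * (real T)\<^sup>2 / c"
  have ln2: "ln (2::real) \<ge> 1/2"
    using ln_le_minus_one[of "1/2::real"] by (simp add: ln_div)
  have l: "l = ln (max 2 y)" by (simp add: l_def y_def tuning_log_def)
  have "ln 2 \<le> ln (max 2 y)" by (rule ln_mono) auto
  then have l_ge: "l \<ge> 1/2" using ln2 l by linarith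
  have Tp: "real T > 0" using assms by simp
  have aT: "a * real T > 0" using assms(1) Tp by simp
  show g0: "0 < \<gamma>"
    unfolding \<gamma>_def stepsize_A_def using assms l_ge aT by (simp add: l_def[symmetric])
  show "\<gamma> \<le> 1 / D" unfolding \<gamma>_def stepsize_A_def by simp
  define E where "E = D * r0 * exp (- a * T / D)"
  define Q where "Q = c / (a * T)"
  have E0: "E \<ge> 0" unfolding E_def using assms by simp
  have Q0: "Q \<ge> 0" unfolding Q_def using assms by simp
  have lE: "E \<le> 5 * l * E"
    using mult_right_mono[OF _ E0, of 1 "5*l"] l_ge by simp
  have "r0 / \<gamma> * exp (- a * \<gamma> * T) + c * \<gamma> \<le> 5 * l * (E + Q)"
  proof (cases "c = 0")
    case True
    then have "\<gamma> = 1 / D" by (simp add: \<gamma>_def stepsize_A_def)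
    then have "r0 / \<gamma> * exp (- a * \<gamma> * T) + c * \<gamma> = E" using True by (simp add: E_def)
    also have "\<dots> \<le> 5 * l * (E + Q)" using lE True by (simp add: Q_def)
    finally show ?thesis .
  next
    case False
    then have c0: "c > 0" using assms by simp
    have gmin: "\<gamma> = min (1/D) (l / (a*T))"
      using False by (simp add: \<gamma>_def stepsize_A_def l_def)
    have "c * \<gamma> \<le> c * (l / (a * T))"
      using c0 gmin by (intro mult_left_mono) auto
    then have cg: "c * \<gamma> \<le> l * Q" by (simp add: Q_def mult.commute)
    have "r0 / \<gamma> * exp (- a * \<gamma> * T) \<le> E + 4 * l * Q"
    proof (cases "\<gamma> = 1 / D")
      case True
      then have "r0 / \<gamma> * exp (- a * \<gamma> * T) = E" by (simp add: E_def)
      moreover have "4 * l * Q \<ge> 0" using l_ge Q0 by simp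
      ultimately show ?thesis by linarith
    next
      case False
      then have g: "\<gamma> = l / (a * T)" using gmin by (simp add: min_def split: if_splits)
      have "exp (- a * \<gamma> * T) = exp (- l)" using g assms(1) Tp by simp
      also have "\<dots> = 1 / max 2 y" by (simp add: l exp_minus inverse_eq_divide)
      finally have ex: "exp (- a * \<gamma> * T) = 1 / max 2 y" .
      have r0y: "r0 * (a * T) = y * Q"
        using c0 aT assms(1) Tp by (simp add: y_def Q_def power2_eq_square)
      have "r0 / \<gamma> * exp (- a * \<gamma> * T) = r0 * (a * T) / l * (1 / max 2 y)"
        unfolding ex by (simp add: g)
      also have "\<dots> = (y / max 2 y) * Q / l" unfolding r0y by simp
      also have "\<dots> \<le> 1 * Q / (1/2)"
      proof (intro frac_le mult_mono)
        show "y / max 2 y \<le> 1" by (simp add: divide_le_eq)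
      qed (use Q0 l_ge in auto)
      also have "\<dots> \<le> 4 * l * Q"
        using mult_right_mono[OF _ Q0, of 2 "4*l"] l_ge by simp
      finally show ?thesis using E0 by linarith
    qed
    then have "r0 / \<gamma> * exp (- a * \<gamma> * T) + c * \<gamma> \<le> E + 5 * l * Q" using cg by linarith
    also have "\<dots> \<le> 5 * l * (E + Q)" using lE by (simp add: distrib_left)
    finally show ?thesis .
  qed
  then show "r0 / \<gamma> * exp (- a * \<gamma> * T) + c * \<gamma>
       \<le> 5 * tuning_log a c r0 T * (D * r0 * exp (- a * T / D) + c / (a * T))"
    by (simp add: l_def E_def Q_def)
qed

end

theory Submission
  imports Defs
begin

text \<open>The virtual iterate \<open>y\<^sub>t = x\<^sub>t - e\<^sub>t\<close> satisfies \<open>y\<^sub>t\<^sub>+\<^sub>1 = y\<^sub>t - \<gamma> g\<^sub>t\<close>, so it runs SGD without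
  compression, with gradients taken at a point at distance \<open>\<parallel>e\<^sub>t\<parallel>\<close>. The compressor contracts the error,
  \<open>E \<parallel>e\<^sub>t\<^sub>+\<^sub>1\<parallel>\<^sup>2 \<le> (1 - \<delta> / 2) E \<parallel>e\<^sub>t\<parallel>\<^sup>2 + \<gamma>\<^sup>2 ((2 / \<delta> + M) E \<parallel>\<nabla>f x\<^sub>t\<parallel>\<^sup>2 + \<sigma>\<^sup>2)\<close>. Hence
  \<open>E \<parallel>y\<^sub>t - x\<^sup>*\<parallel>\<^sup>2 + E \<parallel>e\<^sub>t\<parallel>\<^sup>2\<close> in the quasi-convex case, and \<open>E f y\<^sub>t - f\<^sup>* + (\<gamma> L\<^sup>2 / \<delta>) E \<parallel>e\<^sub>t\<parallel>\<^sup>2\<close> in the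
  non-convex case, are Lyapunov functions that decrease in each step by a multiple of \<open>\<gamma>\<close> times the
  quantity to be bounded, up to a noise term of order \<open>\<gamma>\<^sup>2 \<sigma>\<^sup>2\<close>. Summation with the weights of the output
  index telescopes, and the step size rules balance the two resulting terms.\<close>

subsection \<open>Smooth functions and compressors\<close>

text \<open>The obstacle is probabilistic. The noise is centred only given the query point
  \<open>x t\<close>, while the cross terms pair it with quantities that involve \<open>e t\<close>,
  which depends on the whole past and in general is not a function of \<open>x t\<close>.
  Conditional independence is what turns a zero mean given the query point into a zero mean given
  the past. Nor may expectations be split before integrability is known: a Bochner integral of a
  non-integrable function is 0, and the noise comes only with a conditional bound in
  \<open>[0, \<infinity>]\<close>. Square integrability is therefore carried along the run by
  induction, the noise at time \<open>t\<close> inheriting it from the gradient at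
  \<open>x t\<close>. The cap \<open>\<gamma> \<le> 1 / (10 * L * (a / \<delta> + M))\<close> is
  used twice over: it makes \<open>\<gamma> * L\<close> small against \<open>\<delta>\<close>, so
  that the contraction of the error pays for the distance between \<open>x t\<close> and the virtual
  iterate, and it makes \<open>\<gamma> * L * (a / \<delta> + M)\<close> small against 1, so that
  the descent pays for all squared gradients.\<close>

locale smooth_function =
  fixes f :: "'a::euclidean_space \<Rightarrow> real" and grad :: "'a \<Rightarrow> 'a" and fmin L :: real
  assumes gradient: "GDERIV f x :> grad x"
    and fmin_le: "fmin \<le> f x"
    and L_pos: "L > 0"
    and lipschitz: "norm (grad x - grad y) \<le> L * norm (x - y)"
begin

lemma continuous_on_grad: "continuous_on UNIV grad"
proof -
  have "L-lipschitz_on UNIV grad"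
    using lipschitz L_pos by (auto intro!: lipschitz_onI simp: dist_norm)
  then show ?thesis by (rule lipschitz_on_continuous_on)
qed

lemma continuous_on_f: "continuous_on UNIV f"
  using gradient unfolding gderiv_def
  by (intro has_derivative_continuous_on[of UNIV f "\<lambda>x h. h \<bullet> grad x"]) simp

lemma borel_measurable_grad [measurable]: "grad \<in> borel_measurable borel"
  using continuous_on_grad by (rule borel_measurable_continuous_onI)

lemma borel_measurable_f [measurable]: "f \<in> borel_measurable borel"
  using continuous_on_f by (rule borel_measurable_continuous_onI)

text \<open>Along the segment from \<open>x\<close> to \<open>x + d\<close>, the difference between
  \<open>f\<close> and its quadratic upper model has nonpositive derivative, by Cauchy-Schwarz and
  the Lipschitz bound. The linear and quadratic terms are put into \<open>\<phi>\<close> so that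
  only monotonicity on \<open>[0, 1]\<close> is needed.\<close>

lemma descent: "f (x + d) \<le> f x + grad x \<bullet> d + L / 2 * (norm d)\<^sup>2"
proof -
  define \<phi> where "\<phi> = (\<lambda>t. f (x + t *\<^sub>R d) - t * (grad x \<bullet> d) - L / 2 * t\<^sup>2 * (norm d)\<^sup>2)"
  have d\<phi>: "(\<phi> has_real_derivative
      ((grad (x + t *\<^sub>R d) - grad x) \<bullet> d - L * t * (norm d)\<^sup>2)) (at t)" for t
  proof -
    have "((\<lambda>t. f (x + t *\<^sub>R d)) has_derivative (\<lambda>h. (h *\<^sub>R d) \<bullet> grad (x + t *\<^sub>R d))) (at t)"
      by (rule has_derivative_compose[OF _ gradient[unfolded gderiv_def]])
        (auto intro!: derivative_eq_intros)
    then have "((\<lambda>t. f (x + t *\<^sub>R d)) has_real_derivative grad (x + t *\<^sub>R d) \<bullet> d) (at t)"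
      unfolding has_field_derivative_def
      by (rule has_derivative_eq_rhs) (simp add: fun_eq_iff inner_commute mult.commute)
    note [derivative_intros] = this
    show ?thesis unfolding \<phi>_def
      by (auto intro!: derivative_eq_intros simp: inner_diff_left)
  qed
  have "\<phi> 1 \<le> \<phi> 0"
  proof (rule DERIV_nonpos_imp_nonincreasing[of 0 1 \<phi>])
    fix t :: real assume t: "0 \<le> t" "t \<le> 1"
    have "(grad (x + t *\<^sub>R d) - grad x) \<bullet> d \<le> norm (grad (x + t *\<^sub>R d) - grad x) * norm d"
      by (rule norm_cauchy_schwarz)
    also have "\<dots> \<le> L * norm (t *\<^sub>R d) * norm d"
      using lipschitz[of "x + t *\<^sub>R d" x] by (intro mult_right_mono) auto
    also have "\<dots> = L * t * (norm d)\<^sup>2"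
      using t by (simp add: power2_eq_square)
    finally show "\<exists>y. DERIV \<phi> t :> y \<and> y \<le> 0" using d\<phi>[of t] by auto
  qed simp
  then show ?thesis by (simp add: \<phi>_def)
qed

lemma f_le: "f y \<le> f x + grad x \<bullet> (y - x) + L / 2 * (norm (y - x))\<^sup>2"
  using descent[of x "y - x"] by simp

text \<open>A gradient step of length \<open>1 / L\<close> lowers \<open>f\<close> by at least
  \<open>(norm (grad x))\<^sup>2 / (2 * L)\<close>, and it cannot go below
  \<open>fmin\<close>.\<close>

lemma norm_grad_sq_le: "(norm (grad x))\<^sup>2 \<le> 2 * L * (f x - fmin)"
proof -
  have "f (x + (- (1 / L)) *\<^sub>R grad x) \<le> f x + grad x \<bullet> ((- (1 / L)) *\<^sub>R grad x)
      + L / 2 * (norm ((- (1 / L)) *\<^sub>R grad x))\<^sup>2"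
    by (rule descent)
  also have "\<dots> = f x - (norm (grad x))\<^sup>2 / (2 * L)"
    using L_pos by (simp add: dot_square_norm power_mult_distrib power2_eq_square field_simps)
  finally have "(norm (grad x))\<^sup>2 / (2 * L) \<le> f x - fmin"
    using fmin_le[of "x + (- (1 / L)) *\<^sub>R grad x"] by linarith
  then show ?thesis using L_pos by (simp add: field_simps)
qed

text \<open>At a fixed base point this says that the gradient grows at most linearly, which lets
  square integrability pass from a random point to the gradient there.\<close>

lemma norm_grad_add_sq_le: "(norm (grad (x + d)))\<^sup>2 \<le> 2 * (norm (grad x))\<^sup>2 + 2 * L\<^sup>2 * (norm d)\<^sup>2"
proof -
  have "norm (grad (x + d)) \<le> norm (grad x) + L * norm d"
    using norm_triangle_sub[of "grad (x + d)" "grad x"] lipschitz[of "x + d" x] by simp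
  then have "(norm (grad (x + d)))\<^sup>2 \<le> (norm (grad x) + L * norm d)\<^sup>2"
    by (rule power_mono) simp
  also have "\<dots> \<le> 2 * (norm (grad x))\<^sup>2 + 2 * L\<^sup>2 * (norm d)\<^sup>2"
    using zero_le_power2[of "norm (grad x) - L * norm d"]
    by (simp add: power2_eq_square algebra_simps)
  finally show ?thesis .
qed

text \<open>The first two claims follow by testing at \<open>xs\<close>, the third by testing at
  distance 1 from \<open>xs\<close>. The bound on \<open>\<mu>\<close> later keeps
  \<open>1 - \<mu> * \<gamma> / 2\<close> positive and lets terms in \<open>\<mu>\<close> be
  absorbed into terms in \<open>L\<close>.\<close>

lemma quasi_convex_minimizer:
  assumes "quasi_convex \<mu> f grad fmin xs" "\<mu> \<ge> 0"
  shows "f xs = fmin" "grad xs = 0" "\<mu> \<le> 2 * L"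
proof -
  note qc = assms(1)[unfolded quasi_convex_def, rule_format]
  show f: "f xs = fmin" using qc[of xs] fmin_le[of xs] by simp
  show g: "grad xs = 0" using norm_grad_sq_le[of xs] f by simp
  obtain b :: 'a where b: "norm b = 1" using norm_Basis nonempty_Basis by blast
  have "\<mu> / 2 \<le> grad (xs + b) \<bullet> b" using qc[of "xs + b"] fmin_le[of "xs + b"] b by simp
  also have "\<dots> \<le> norm (grad (xs + b)) * norm b" by (rule norm_cauchy_schwarz)
  also have "\<dots> \<le> L" using lipschitz[of "xs + b" xs] b g by simp
  finally show "\<mu> \<le> 2 * L" by simp
qed

end

text \<open>A mean square is nonnegative, so a unit vector as input forces this. It makes
  \<open>1 - \<delta>\<close> a factor by which inequalities may be multiplied.\<close>

lemma approx_compressor_delta_le_1: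
  fixes C :: "'a::euclidean_space \<Rightarrow> 's \<Rightarrow> 'a"
  assumes "approx_compressor \<delta> S C"
  shows "\<delta> \<le> 1"
proof -
  obtain b :: 'a where b: "norm b = 1" using norm_Basis nonempty_Basis by blast
  have "0 \<le> (\<integral>s. (norm (b - C b s))\<^sup>2 \<partial>S)" by simp
  also have "\<dots> \<le> (1 - \<delta>) * (norm b)\<^sup>2" using assms by (simp add: approx_compressor_def)
  finally show ?thesis using b by simp
qed

lemma two_inner_le:
  fixes a b :: "'a::real_inner"
  assumes "\<rho> > 0"
  shows "2 * (a \<bullet> b) \<le> \<rho> * (norm a)\<^sup>2 + (norm b)\<^sup>2 / \<rho>"
proof -
  have "0 \<le> (norm (\<rho> *\<^sub>R a - b))\<^sup>2 / \<rho>" using assms by simp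
  also have "(norm (\<rho> *\<^sub>R a - b))\<^sup>2 = \<rho>\<^sup>2 * (norm a)\<^sup>2 - 2 * \<rho> * (a \<bullet> b) + (norm b)\<^sup>2"
    by (simp add: power2_norm_eq_inner inner_diff_left inner_diff_right inner_commute
        flip: power2_eq_square)
  finally show ?thesis using assms by (simp add: field_simps power2_eq_square)
qed

text \<open>Young's inequality with weight \<open>\<delta> / 2\<close> spends half of the
  contraction on the cross term. The coefficient left for \<open>b\<close> is
  \<open>(1 - \<delta>) * (1 + 2 / \<delta>)\<close>, which is at most
  \<open>2 / \<delta>\<close>.\<close>

lemma contraction_norm_add_sq_le:
  fixes a b :: "'a::real_inner"
  assumes "0 < \<delta>" "\<delta> \<le> 1"
  shows "(1 - \<delta>) * (norm (a + b))\<^sup>2 \<le> (1 - \<delta> / 2) * (norm a)\<^sup>2 + 2 / \<delta> * (norm b)\<^sup>2"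
proof -
  have "(1 - \<delta>) * (2 * (a \<bullet> b)) \<le> 1 * (\<delta> / 2 * (norm a)\<^sup>2) + (1 - \<delta>) * ((norm b)\<^sup>2 / (\<delta> / 2))"
  proof -
    have "(1 - \<delta>) * (2 * (a \<bullet> b)) \<le> (1 - \<delta>) * (\<delta> / 2 * (norm a)\<^sup>2 + (norm b)\<^sup>2 / (\<delta> / 2))"
      using assms by (intro mult_left_mono two_inner_le) auto
    also have "\<dots> \<le> 1 * (\<delta> / 2 * (norm a)\<^sup>2) + (1 - \<delta>) * ((norm b)\<^sup>2 / (\<delta> / 2))"
      unfolding distrib_left using assms by (intro add_right_mono mult_right_mono) auto
    finally show ?thesis .
  qed
  moreover have "(1 - \<delta>) * (norm b)\<^sup>2 + (1 - \<delta>) * ((norm b)\<^sup>2 / (\<delta> / 2)) \<le> 2 / \<delta> * (norm b)\<^sup>2"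
    using assms by (simp add: field_simps)
  moreover have "(norm (a + b))\<^sup>2 = (norm a)\<^sup>2 + 2 * (a \<bullet> b) + (norm b)\<^sup>2"
    by (simp add: power2_norm_eq_inner inner_add_left inner_add_right inner_commute)
  ultimately show ?thesis by (simp add: algebra_simps)
qed

subsection \<open>Conditional independence and square integrability\<close>

lemma subalgebra_vimage_algebra:
  assumes "X \<in> measurable P N"
  shows "subalgebra P (vimage_algebra (space P) X N)"
  using assms by (auto simp: subalgebra_def sets_vimage_algebra2 measurable_space)

lemma subalgebra_history:
  assumes "\<And>i. i < m \<Longrightarrow> \<xi> i \<in> borel_measurable P" "\<And>i. i < n \<Longrightarrow> s i \<in> measurable P S"
  shows "subalgebra P (history P S \<xi> s m n)"
proof -
  have "(\<Union>i<m. gen_sets P borel (\<xi> i)) \<union> (\<Union>i<n. gen_sets P S (s i)) \<subseteq> sets P"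
    using assms by (auto simp: gen_sets_def intro!: measurable_sets)
  moreover have "(\<Union>i<m. gen_sets P borel (\<xi> i)) \<union> (\<Union>i<n. gen_sets P S (s i)) \<subseteq> Pow (space P)"
    by (auto simp: gen_sets_def)
  ultimately show ?thesis
    by (simp add: subalgebra_def history_def sets.sigma_sets_subset)
qed

lemma sets_history:
  "sets (history P S \<xi> s m n)
    = sigma_sets (space P) ((\<Union>i<m. gen_sets P borel (\<xi> i)) \<union> (\<Union>i<n. gen_sets P S (s i)))"
  unfolding history_def by (rule sets_measure_of) (auto simp: gen_sets_def)

lemma space_history [simp]: "space (history P S \<xi> s m n) = space P"
  by (simp add: history_def space_measure_of_conv)

lemma measurable_history_noise: "i < m \<Longrightarrow> \<xi> i \<in> borel_measurable (history P S \<xi> s m n)"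
  by (rule measurableI) (auto simp: sets_history gen_sets_def intro!: sigma_sets.Basic)

lemma measurable_history_seed:
  assumes "i < n" "s i \<in> measurable P S"
  shows "s i \<in> measurable (history P S \<xi> s m n) S"
  using assms measurable_space[OF assms(2)]
  by (intro measurableI) (auto simp: sets_history gen_sets_def intro!: sigma_sets.Basic)

lemma sets_history_mono:
  assumes "m \<le> m'" "n \<le> n'"
  shows "sets (history P S \<xi> s m n) \<subseteq> sets (history P S \<xi> s m' n')"
  unfolding sets_history using assms
  by (intro sigma_sets_mono' Un_mono UN_mono) auto

lemma measurable_history_mono:
  assumes "X \<in> measurable (history P S \<xi> s m n) N" "m \<le> m'" "n \<le> n'"
  shows "X \<in> measurable (history P S \<xi> s m' n') N"
  using sets_history_mono[OF assms(2,3)] assms(1) unfolding measurable_def space_history by blast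

text \<open>Both sides integrate \<open>\<phi>\<close> against an image measure under \<open>\<xi>\<close>, with density \<open>indicator A\<close> on the left
  and the conditional probability of \<open>A\<close> on the right; conditional independence makes these two image
  measures equal.\<close>

lemma (in prob_space) cond_indep_sets_integral:
  fixes \<phi> :: "'b::topological_space \<Rightarrow> real"
  assumes G: "subalgebra M G" and F: "subalgebra M F"
    and indep: "cond_indep_sets M G (gen_sets M borel \<xi>) (sets F)"
    and [measurable]: "\<xi> \<in> borel_measurable M" "\<phi> \<in> borel_measurable borel"
    and A: "A \<in> sets F"
  shows "(\<integral>\<omega>. indicator A \<omega> * \<phi> (\<xi> \<omega>) \<partial>M) = (\<integral>\<omega>. real_cond_exp M G (indicator A) \<omega> * \<phi> (\<xi> \<omega>) \<partial>M)"
proof -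
  interpret G: finite_measure_subalgebra M G by unfold_locales (rule G)
  have [measurable]: "A \<in> sets M" using A F by (auto simp: subalgebra_def)
  define Z where "Z = real_cond_exp M G (indicator A)"
  have [measurable]: "Z \<in> borel_measurable M" "Z \<in> borel_measurable G"
    by (simp_all add: Z_def)
  have Z0: "AE \<omega> in M. 0 \<le> Z \<omega>" unfolding Z_def by (rule G.real_cond_exp_pos) auto
  have iZ: "integrable M Z" unfolding Z_def by (rule G.real_cond_exp_int(1)) (simp add: emeasure_eq_measure)
  \<comment> \<open>On events of \<open>\<xi>\<close>: conditional independence factors the
    conditional probability of the intersection, and since \<open>Z\<close> is
    \<open>G\<close>-measurable, the conditional probability of the other factor may be replaced by
    its indicator under the integral.\<close>
  have key: "prob (\<xi> -` B \<inter> space M \<inter> A) = (\<integral>\<omega>. Z \<omega> * indicator (\<xi> -` B \<inter> space M) \<omega> \<partial>M)"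
    if B: "B \<in> sets borel" for B
  proof -
    define B' where "B' = \<xi> -` B \<inter> space M"
    have [measurable]: "B' \<in> sets M" using B by (simp add: B'_def)
    have iZB: "integrable M (\<lambda>\<omega>. Z \<omega> * indicator B' \<omega>)"
      by (rule Bochner_Integration.integrable_bound[OF iZ]) (auto simp: indicator_def)
    have "prob (B' \<inter> A) = (\<integral>\<omega>. indicator (B' \<inter> A) \<omega> \<partial>M)" by simp
    also have "\<dots> = (\<integral>\<omega>. real_cond_exp M G (indicator (B' \<inter> A)) \<omega> \<partial>M)"
      by (rule G.real_cond_exp_int(2)[symmetric]) (simp add: emeasure_eq_measure)
    also have "\<dots> = (\<integral>\<omega>. Z \<omega> * real_cond_exp M G (indicator B') \<omega> \<partial>M)"
    proof (rule integral_cong_AE)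
      have "B' \<in> gen_sets M borel \<xi>" using B by (auto simp: gen_sets_def B'_def)
      then show "AE \<omega> in M. real_cond_exp M G (indicator (B' \<inter> A)) \<omega> =
          Z \<omega> * real_cond_exp M G (indicator B') \<omega>"
        using indep A unfolding cond_indep_sets_def Z_def by (subst mult.commute) blast
    qed auto
    also have "\<dots> = (\<integral>\<omega>. Z \<omega> * indicator B' \<omega> \<partial>M)"
      using iZB by (rule G.real_cond_exp_intg(2)) auto
    finally show ?thesis by (simp add: B'_def)
  qed
  \<comment> \<open>Equality of measures gives the integral identity for every measurable
    \<open>\<phi>\<close> at once, so no integrability has to be checked.\<close>
  have "distr (density M (indicator A)) borel \<xi> = distr (density M Z) borel \<xi>"
  proof (rule measure_eqI)
    fix B assume "B \<in> sets (distr (density M (indicator A)) borel \<xi>)"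
    then have B: "B \<in> sets borel" by simp
    define B' where "B' = \<xi> -` B \<inter> space M"
    have B'm [measurable]: "B' \<in> sets M" using B by (simp add: B'_def)
    have "integrable M (\<lambda>\<omega>. Z \<omega> * indicator B' \<omega>)"
      by (rule Bochner_Integration.integrable_bound[OF iZ]) (auto simp: indicator_def)
    then have "ennreal (\<integral>\<omega>. Z \<omega> * indicator B' \<omega> \<partial>M) = (\<integral>\<^sup>+\<omega>. ennreal (Z \<omega> * indicator B' \<omega>) \<partial>M)"
      using Z0 by (intro nn_integral_eq_integral[symmetric]) auto
    also have "\<dots> = (\<integral>\<^sup>+\<omega>. ennreal (Z \<omega>) * indicator B' \<omega> \<partial>M)"
      by (intro nn_integral_cong) (auto simp: indicator_def)
    finally have "emeasure (density M Z) B' = emeasure M (B' \<inter> A)"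
      using key[OF B, folded B'_def] by (simp add: emeasure_density emeasure_eq_measure)
    moreover have "emeasure (density M (indicator A)) B' = emeasure M (B' \<inter> A)"
      by (simp add: emeasure_density Int_commute indicator_inter_arith[symmetric])
    ultimately show "emeasure (distr (density M (indicator A)) borel \<xi>) B = emeasure (distr (density M Z) borel \<xi>) B"
      using B by (simp add: emeasure_distr B'_def)
  qed simp
  moreover have "(\<integral>y. \<phi> y \<partial>distr (density M (indicator A)) borel \<xi>) = (\<integral>\<omega>. indicator A \<omega> * \<phi> (\<xi> \<omega>) \<partial>M)"
  proof -
    have "(indicator A :: _ \<Rightarrow> ennreal) = (\<lambda>\<omega>. ennreal (indicator A \<omega>))"
      by (auto simp: indicator_def)
    then show ?thesis by (simp add: integral_distr integral_density)
  qed
  moreover have "(\<integral>y. \<phi> y \<partial>distr (density M Z) borel \<xi>) = (\<integral>\<omega>. Z \<omega> * \<phi> (\<xi> \<omega>) \<partial>M)"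
    using Z0 by (simp add: integral_distr integral_density)
  ultimately show ?thesis by (simp add: Z_def)
qed

section \<open>Square-integrable random vectors; moments of the noise and of the compression
  error\<close>

definition square_integrable :: "'w measure \<Rightarrow> ('w \<Rightarrow> 'a::euclidean_space) \<Rightarrow> bool" where
  "square_integrable P X \<longleftrightarrow> X \<in> borel_measurable P \<and> integrable P (\<lambda>\<omega>. (norm (X \<omega>))\<^sup>2)"

lemma square_integrableD:
  assumes "square_integrable P X"
  shows "X \<in> borel_measurable P" "integrable P (\<lambda>\<omega>. (norm (X \<omega>))\<^sup>2)"
  using assms by (auto simp: square_integrable_def)

lemma square_integrable_cong:
  assumes "\<And>\<omega>. \<omega> \<in> space P \<Longrightarrow> X \<omega> = Y \<omega>"
  shows "square_integrable P X \<longleftrightarrow> square_integrable P Y"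
  using assms by (simp add: square_integrable_def cong: measurable_cong Bochner_Integration.integrable_cong)

lemma square_integrable_scaleR:
  "square_integrable P X \<Longrightarrow> square_integrable P (\<lambda>\<omega>. c *\<^sub>R X \<omega>)"
  by (auto simp: square_integrable_def power_mult_distrib)

lemma norm_add_sq_le:
  fixes a b :: "'a::real_inner"
  shows "(norm (a + b))\<^sup>2 \<le> 2 * (norm a)\<^sup>2 + 2 * (norm b)\<^sup>2"
  using two_inner_le[of 1 a b]
  by (simp add: power2_norm_eq_inner inner_add_left inner_add_right inner_commute)

lemma square_integrable_add:
  assumes "square_integrable P X" "square_integrable P Y"
  shows "square_integrable P (\<lambda>\<omega>. X \<omega> + Y \<omega>)"
proof -
  note [measurable] = square_integrableD(1)[OF assms(1)] square_integrableD(1)[OF assms(2)]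
  have "integrable P (\<lambda>\<omega>. 2 * (norm (X \<omega>))\<^sup>2 + 2 * (norm (Y \<omega>))\<^sup>2)"
    using assms by (auto simp: square_integrable_def)
  then have "integrable P (\<lambda>\<omega>. (norm (X \<omega> + Y \<omega>))\<^sup>2)"
    by (rule Bochner_Integration.integrable_bound) (auto intro: norm_add_sq_le)
  then show ?thesis by (simp add: square_integrable_def)
qed

lemma square_integrable_diff:
  assumes "square_integrable P X" "square_integrable P Y"
  shows "square_integrable P (\<lambda>\<omega>. X \<omega> - Y \<omega>)"
  using square_integrable_add[OF assms(1) square_integrable_scaleR[OF assms(2), of "-1"]] by simp

lemma (in prob_space) square_integrable_const: "square_integrable M (\<lambda>\<omega>. c)"
  by (simp add: square_integrable_def)

lemma square_integrable_inner:
  assumes "square_integrable P X" "square_integrable P Y"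
  shows "integrable P (\<lambda>\<omega>. X \<omega> \<bullet> Y \<omega>)"
proof -
  note [measurable] = square_integrableD(1)[OF assms(1)] square_integrableD(1)[OF assms(2)]
  have i: "integrable P (\<lambda>\<omega>. (norm (X \<omega>))\<^sup>2 + (norm (Y \<omega>))\<^sup>2)"
    using assms by (auto simp: square_integrable_def)
  have "\<bar>a \<bullet> b\<bar> \<le> (norm a)\<^sup>2 + (norm b)\<^sup>2" for a b :: 'b
    using two_inner_le[of 1 a b] two_inner_le[of 1 "-a" b]
      zero_le_power2[of "norm a"] zero_le_power2[of "norm b"] by simp
  then show ?thesis
    by (intro Bochner_Integration.integrable_bound[OF i]) auto
qed

lemma square_integrable_inner_const:
  assumes "square_integrable P X"
  shows "square_integrable P (\<lambda>\<omega>. X \<omega> \<bullet> b)"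
proof -
  note [measurable] = square_integrableD(1)[OF assms]
  have i: "integrable P (\<lambda>\<omega>. (norm (X \<omega>))\<^sup>2 * (norm b)\<^sup>2)"
    using assms by (auto simp: square_integrable_def)
  have "(x \<bullet> b)\<^sup>2 \<le> (norm x)\<^sup>2 * (norm b)\<^sup>2" for x
    using Cauchy_Schwarz_ineq[of x b] by (simp add: power2_norm_eq_inner)
  then have "integrable P (\<lambda>\<omega>. (X \<omega> \<bullet> b)\<^sup>2)"
    by (intro Bochner_Integration.integrable_bound[OF i]) auto
  then show ?thesis by (simp add: square_integrable_def)
qed

lemma (in prob_space) square_integrable_imp_integrable:
  fixes X :: "'a \<Rightarrow> real"
  assumes "square_integrable M X"
  shows "integrable M X"
  using square_integrable_inner[OF assms square_integrable_const[of 1]] by simp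

lemma (in prob_space) expectation_norm_add_sq:
  assumes "square_integrable M X" "square_integrable M Y"
  shows "expectation (\<lambda>\<omega>. (norm (X \<omega> + Y \<omega>))\<^sup>2)
    = expectation (\<lambda>\<omega>. (norm (X \<omega>))\<^sup>2) + 2 * expectation (\<lambda>\<omega>. X \<omega> \<bullet> Y \<omega>) + expectation (\<lambda>\<omega>. (norm (Y \<omega>))\<^sup>2)"
proof -
  have "(norm (X \<omega> + Y \<omega>))\<^sup>2 = (norm (X \<omega>))\<^sup>2 + 2 * (X \<omega> \<bullet> Y \<omega>) + (norm (Y \<omega>))\<^sup>2" for \<omega>
    by (simp add: power2_norm_eq_inner inner_add_left inner_add_right inner_commute)
  then show ?thesis
    using assms square_integrable_inner[OF assms] by (simp add: square_integrableD)
qed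

text \<open>Integrating the conditional bound in \<open>[0, \<infinity>]\<close> shows first that
  the second moment is finite; only then is the estimate read as one between real
  expectations.\<close>

lemma (in prob_space) bounded_noise_second_moment:
  assumes "bounded_noise K \<sigma> grad M F x \<xi>" "K \<ge> 0"
    and x: "x \<in> borel_measurable M" and gx: "square_integrable M (\<lambda>\<omega>. grad (x \<omega>))"
  shows "square_integrable M \<xi>"
    and "expectation (\<lambda>\<omega>. (norm (\<xi> \<omega>))\<^sup>2) \<le> K * expectation (\<lambda>\<omega>. (norm (grad (x \<omega>)))\<^sup>2) + \<sigma>\<^sup>2"
proof -
  let ?G = "vimage_algebra (space M) x borel"
  interpret G: finite_measure_subalgebra M ?G
    by unfold_locales (rule subalgebra_vimage_algebra[OF x])
  have [measurable]: "\<xi> \<in> borel_measurable M" using assms by (simp add: bounded_noise_def)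
  define R where "R = K * expectation (\<lambda>\<omega>. (norm (grad (x \<omega>)))\<^sup>2) + \<sigma>\<^sup>2"
  have R0: "0 \<le> R" unfolding R_def using assms by (intro add_nonneg_nonneg mult_nonneg_nonneg) auto
  have "(\<integral>\<^sup>+\<omega>. ennreal ((norm (\<xi> \<omega>))\<^sup>2) \<partial>M)
      = (\<integral>\<^sup>+\<omega>. nn_cond_exp M ?G (\<lambda>\<omega>. ennreal ((norm (\<xi> \<omega>))\<^sup>2)) \<omega> \<partial>M)"
    using G.nn_cond_exp_intg[of "\<lambda>_. 1" "\<lambda>\<omega>. ennreal ((norm (\<xi> \<omega>))\<^sup>2)"] by simp
  also have "\<dots> \<le> (\<integral>\<^sup>+\<omega>. ennreal (K * (norm (grad (x \<omega>)))\<^sup>2 + \<sigma>\<^sup>2) \<partial>M)"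
    using assms by (intro nn_integral_mono_AE) (simp add: bounded_noise_def)
  also have "\<dots> = ennreal R"
    using square_integrableD[OF gx] assms(2)
    by (subst nn_integral_eq_integral) (auto simp: R_def prob_space)
  finally have le: "(\<integral>\<^sup>+\<omega>. ennreal ((norm (\<xi> \<omega>))\<^sup>2) \<partial>M) \<le> ennreal R" .
  then have i: "integrable M (\<lambda>\<omega>. (norm (\<xi> \<omega>))\<^sup>2)"
    by (intro integrableI_bounded) (auto simp: le_less_trans[OF _ ennreal_less_top])
  then show "square_integrable M \<xi>" by (simp add: square_integrable_def)
  show "expectation (\<lambda>\<omega>. (norm (\<xi> \<omega>))\<^sup>2) \<le> K * expectation (\<lambda>\<omega>. (norm (grad (x \<omega>)))\<^sup>2) + \<sigma>\<^sup>2"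
    using le R0 i by (simp add: nn_integral_eq_integral R_def)
qed

text \<open>For an event \<open>A\<close> of the past and a coordinate of \<open>\<xi>\<close>,
  conditional independence replaces \<open>indicator A\<close> by its conditional probability given
  \<open>x\<close>. This is a function of \<open>x\<close>, against which the coordinate integrates
  to 0. Hence the conditional mean given the past vanishes too, and the factor \<open>Y\<close> may
  be any square-integrable function of the past. The argument is coordinatewise because
  \<open>real_cond_exp\<close> is scalar.\<close>

lemma (in prob_space) bounded_noise_orthogonal:
  assumes noise: "bounded_noise K \<sigma> grad M F x \<xi>"
    and x: "x \<in> borel_measurable M" and \<xi>: "square_integrable M \<xi>"
    and F: "subalgebra M F" and Y: "Y \<in> borel_measurable F" "square_integrable M Y"
  shows "expectation (\<lambda>\<omega>. Y \<omega> \<bullet> \<xi> \<omega>) = 0"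
proof -
  let ?G = "vimage_algebra (space M) x borel"
  have G: "subalgebra M ?G" by (rule subalgebra_vimage_algebra[OF x])
  interpret G: finite_measure_subalgebra M ?G by unfold_locales (rule G)
  interpret F: finite_measure_subalgebra M F by unfold_locales (rule F)
  note [measurable] = square_integrableD(1)[OF \<xi>] square_integrableD(1)[OF Y(2)] Y(1)
  have zero: "expectation (\<lambda>\<omega>. (Y \<omega> \<bullet> b) * (\<xi> \<omega> \<bullet> b)) = 0" if b: "b \<in> Basis" for b
  proof -
    have i\<xi>: "integrable M (\<lambda>\<omega>. \<xi> \<omega> \<bullet> b)"
      by (rule square_integrable_imp_integrable[OF square_integrable_inner_const[OF \<xi>]])
    have G0: "AE \<omega> in M. real_cond_exp M ?G (\<lambda>\<omega>. \<xi> \<omega> \<bullet> b) \<omega> = 0"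
      using noise b by (simp add: bounded_noise_def)
    have "AE \<omega> in M. real_cond_exp M F (\<lambda>\<omega>. \<xi> \<omega> \<bullet> b) \<omega> = 0"
    proof (rule F.real_cond_exp_charact)
      fix A assume A: "A \<in> sets F"
      then have [measurable]: "A \<in> sets M" using F by (auto simp: subalgebra_def)
      define Z where "Z = real_cond_exp M ?G (indicator A)"
      have iA: "integrable M (indicator A :: _ \<Rightarrow> real)" by (simp add: emeasure_eq_measure)
      have [measurable]: "Z \<in> borel_measurable M" "Z \<in> borel_measurable ?G"
        by (simp_all add: Z_def)
      \<comment> \<open>A conditional probability lies between 0 and 1 almost everywhere, which
        gives the integrability needed to condition the product below.\<close>
      have "AE \<omega> in M. 0 \<le> Z \<omega>" unfolding Z_def by (rule G.real_cond_exp_pos) auto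
      moreover have "AE \<omega> in M. Z \<omega> \<le> 1" unfolding Z_def
        by (rule G.real_cond_exp_le_c[OF iA]) (auto simp: indicator_def)
      ultimately have "AE \<omega> in M. norm (Z \<omega> * (\<xi> \<omega> \<bullet> b)) \<le> norm (\<xi> \<omega> \<bullet> b)"
        by eventually_elim (auto simp: abs_mult intro: mult_left_le_one_le)
      then have iZ: "integrable M (\<lambda>\<omega>. Z \<omega> * (\<xi> \<omega> \<bullet> b))"
        by (intro Bochner_Integration.integrable_bound[OF i\<xi>]) auto
      have "(\<integral>\<omega>\<in>A. \<xi> \<omega> \<bullet> b \<partial>M) = (\<integral>\<omega>. indicator A \<omega> * (\<xi> \<omega> \<bullet> b) \<partial>M)"
        by (simp add: set_lebesgue_integral_def)
      also have "\<dots> = (\<integral>\<omega>. Z \<omega> * (\<xi> \<omega> \<bullet> b) \<partial>M)"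
        unfolding Z_def using noise A
        by (intro cond_indep_sets_integral[OF G F]) (auto simp: bounded_noise_def)
      also have "\<dots> = (\<integral>\<omega>. Z \<omega> * real_cond_exp M ?G (\<lambda>\<omega>. \<xi> \<omega> \<bullet> b) \<omega> \<partial>M)"
        using iZ by (intro G.real_cond_exp_intg(2)[symmetric]) auto
      also have "\<dots> = 0"
        using G0 by (intro integral_eq_zero_AE) (auto elim: eventually_mono)
      finally show "(\<integral>\<omega>\<in>A. \<xi> \<omega> \<bullet> b \<partial>M) = (\<integral>\<omega>\<in>A. 0 \<partial>M)" by simp
    qed (use i\<xi> in auto)
    moreover have "integrable M (\<lambda>\<omega>. (Y \<omega> \<bullet> b) * (\<xi> \<omega> \<bullet> b))"
      using square_integrable_inner[OF square_integrable_inner_const[OF Y(2)]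
          square_integrable_inner_const[OF \<xi>]] by simp
    then have "expectation (\<lambda>\<omega>. (Y \<omega> \<bullet> b) * (\<xi> \<omega> \<bullet> b))
        = expectation (\<lambda>\<omega>. (Y \<omega> \<bullet> b) * real_cond_exp M F (\<lambda>\<omega>. \<xi> \<omega> \<bullet> b) \<omega>)"
      by (intro F.real_cond_exp_intg(2)[symmetric]) auto
    ultimately show ?thesis
      by (auto intro!: integral_eq_zero_AE elim!: eventually_mono)
  qed
  have "expectation (\<lambda>\<omega>. Y \<omega> \<bullet> \<xi> \<omega>) = expectation (\<lambda>\<omega>. \<Sum>b\<in>Basis. (Y \<omega> \<bullet> b) * (\<xi> \<omega> \<bullet> b))"
    by (simp add: euclidean_inner[symmetric])
  also have "\<dots> = (\<Sum>b\<in>Basis. expectation (\<lambda>\<omega>. (Y \<omega> \<bullet> b) * (\<xi> \<omega> \<bullet> b)))"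
    using square_integrable_inner[OF square_integrable_inner_const[OF Y(2)]
          square_integrable_inner_const[OF \<xi>]] by (intro Bochner_Integration.integral_sum) simp
  also have "\<dots> = 0" using zero by simp
  finally show ?thesis .
qed

text \<open>The input is a function of the past and the seed is independent of it, so their joint
  law is a product. Tonelli then freezes the input, and the compressor bound for deterministic
  arguments applies inside the outer integral. Working with nonnegative integrals yields
  integrability as a by-product.\<close>

lemma (in prob_space) compressor_error:
  fixes C :: "'b::euclidean_space \<Rightarrow> 's \<Rightarrow> 'b"
  assumes C: "approx_compressor \<delta> S C" and s: "fresh_seed M S F s"
    and F: "subalgebra M F" and y: "y \<in> borel_measurable F" "square_integrable M y"
  shows "square_integrable M (\<lambda>\<omega>. y \<omega> - C (y \<omega>) (s \<omega>))"
    and "expectation (\<lambda>\<omega>. (norm (y \<omega> - C (y \<omega>) (s \<omega>)))\<^sup>2) \<le> (1 - \<delta>) * expectation (\<lambda>\<omega>. (norm (y \<omega>))\<^sup>2)"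
proof -
  interpret S: prob_space S using C by (simp add: approx_compressor_def)
  have Cm [measurable]: "(\<lambda>(x, s). C x s) \<in> borel_measurable (borel \<Otimes>\<^sub>M S)"
    using C by (simp add: approx_compressor_def)
  have [measurable]: "s \<in> measurable M S" and sS: "distr M S s = S"
    and ind: "indep_set (sets F) (gen_sets M S s)"
    using s by (auto simp: fresh_seed_def)
  note [measurable] = square_integrableD(1)[OF y(2)]
  interpret Y: prob_space "distr M borel y" by (rule prob_space_distr) simp
  have law: "distr M borel y \<Otimes>\<^sub>M S = distr M (borel \<Otimes>\<^sub>M S) (\<lambda>\<omega>. (y \<omega>, s \<omega>))"
  proof (rule pair_measure_eqI)
    fix A B assume "A \<in> sets (distr M borel y)" and B [measurable]: "B \<in> sets S"
    then have A [measurable]: "A \<in> sets borel" by simp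
    have "y -` A \<inter> space M \<in> sets F"
      using measurable_sets[OF y(1) A] F by (simp add: subalgebra_def)
    moreover have "s -` B \<inter> space M \<in> gen_sets M S s" using B by (auto simp: gen_sets_def)
    ultimately have "prob ((y -` A \<inter> space M) \<inter> (s -` B \<inter> space M))
        = prob (y -` A \<inter> space M) * prob (s -` B \<inter> space M)"
      by (rule indep_setD[OF ind])
    moreover have "(y -` A \<inter> space M) \<inter> (s -` B \<inter> space M) = (\<lambda>\<omega>. (y \<omega>, s \<omega>)) -` (A \<times> B) \<inter> space M"
      by auto
    moreover have "emeasure S B = emeasure M (s -` B \<inter> space M)"
      by (subst sS[symmetric]) (simp add: emeasure_distr)
    ultimately show "emeasure (distr M borel y) A * emeasure S B
        = emeasure (distr M (borel \<Otimes>\<^sub>M S) (\<lambda>\<omega>. (y \<omega>, s \<omega>))) (A \<times> B)"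
      by (simp add: emeasure_distr emeasure_eq_measure ennreal_mult'')
  qed (unfold_locales, simp)
  have \<delta>: "\<delta> \<le> 1" using C by (rule approx_compressor_delta_le_1)
  have "(\<integral>\<^sup>+\<omega>. ennreal ((norm (y \<omega> - C (y \<omega>) (s \<omega>)))\<^sup>2) \<partial>M)
      = (\<integral>\<^sup>+p. ennreal ((norm (fst p - (\<lambda>(x, s). C x s) p))\<^sup>2) \<partial>distr M (borel \<Otimes>\<^sub>M S) (\<lambda>\<omega>. (y \<omega>, s \<omega>)))"
    by (subst nn_integral_distr) auto
  also have "\<dots> = (\<integral>\<^sup>+x. \<integral>\<^sup>+u. ennreal ((norm (x - C x u))\<^sup>2) \<partial>S \<partial>distr M borel y)"
    unfolding law[symmetric] by (subst S.nn_integral_fst[symmetric]) auto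
  also have "\<dots> = (\<integral>\<^sup>+\<omega>. \<integral>\<^sup>+u. ennreal ((norm (y \<omega> - C (y \<omega>) u))\<^sup>2) \<partial>S \<partial>M)"
    by (subst nn_integral_distr) auto
  also have "\<dots> \<le> (\<integral>\<^sup>+\<omega>. ennreal ((1 - \<delta>) * (norm (y \<omega>))\<^sup>2) \<partial>M)"
  proof (rule nn_integral_mono)
    fix \<omega>
    have "integrable S (\<lambda>u. (norm (y \<omega> - C (y \<omega>) u))\<^sup>2)"
      "(\<integral>u. (norm (y \<omega> - C (y \<omega>) u))\<^sup>2 \<partial>S) \<le> (1 - \<delta>) * (norm (y \<omega>))\<^sup>2"
      using C by (auto simp: approx_compressor_def)
    then show "(\<integral>\<^sup>+u. ennreal ((norm (y \<omega> - C (y \<omega>) u))\<^sup>2) \<partial>S) \<le> ennreal ((1 - \<delta>) * (norm (y \<omega>))\<^sup>2)"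
      by (subst nn_integral_eq_integral) (auto intro: ennreal_leI)
  qed
  also have "\<dots> = ennreal ((1 - \<delta>) * expectation (\<lambda>\<omega>. (norm (y \<omega>))\<^sup>2))"
    using square_integrableD[OF y(2)] \<delta> by (subst nn_integral_eq_integral) auto
  finally have le: "(\<integral>\<^sup>+\<omega>. ennreal ((norm (y \<omega> - C (y \<omega>) (s \<omega>)))\<^sup>2) \<partial>M)
      \<le> ennreal ((1 - \<delta>) * expectation (\<lambda>\<omega>. (norm (y \<omega>))\<^sup>2))" .
  have [measurable]: "(\<lambda>\<omega>. C (y \<omega>) (s \<omega>)) \<in> borel_measurable M"
    using measurable_compose[OF _ Cm, of "\<lambda>\<omega>. (y \<omega>, s \<omega>)" M] by simp
  have i: "integrable M (\<lambda>\<omega>. (norm (y \<omega> - C (y \<omega>) (s \<omega>)))\<^sup>2)"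
    using le by (intro integrableI_bounded) (auto simp: le_less_trans[OF _ ennreal_less_top])
  then show "square_integrable M (\<lambda>\<omega>. y \<omega> - C (y \<omega>) (s \<omega>))"
    by (simp add: square_integrable_def)
  show "expectation (\<lambda>\<omega>. (norm (y \<omega> - C (y \<omega>) (s \<omega>)))\<^sup>2) \<le> (1 - \<delta>) * expectation (\<lambda>\<omega>. (norm (y \<omega>))\<^sup>2)"
    using le \<delta> i by (simp add: nn_integral_eq_integral)
qed

subsection \<open>Averages and step sizes\<close>

text \<open>The factor \<open>q\<close> in front of \<open>\<Phi>\<close> telescopes against the weights \<open>1 / q ^ t\<close>.\<close>

lemma weighted_telescope:
  fixes \<Phi> F :: "nat \<Rightarrow> real"
  assumes "q > 0" "\<And>t. \<Phi> (Suc t) \<le> q * \<Phi> t - c * F t + B"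
  shows "c * (\<Sum>t<T. F t / q ^ t) + q * \<Phi> T / q ^ T \<le> q * \<Phi> 0 + B * (\<Sum>t<T. 1 / q ^ t)"
proof (induction T)
  case (Suc T)
  have "c * F T / q ^ T + \<Phi> (Suc T) / q ^ T \<le> (q * \<Phi> T + B) / q ^ T"
    using assms(2)[of T] assms(1) by (simp add: add_divide_distrib[symmetric] divide_right_mono)
  moreover have "q * \<Phi> (Suc T) / q ^ Suc T = \<Phi> (Suc T) / q ^ T" using assms(1) by simp
  ultimately show ?case using Suc by (simp add: add_divide_distrib algebra_simps)
qed simp

text \<open>The normalizer is at least its last term \<open>1 / q ^ (T - 1)\<close>, so dividing the
  initial term \<open>q * \<Phi> 0\<close> by it leaves at most \<open>q ^ T * \<Phi> 0\<close>; the
  factor \<open>q\<close> kept by the telescoped sum makes up for the exponent \<open>T - 1\<close>.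
  The weights of \<open>B\<close> sum to the normalizer itself.\<close>

lemma weighted_average_bound:
  fixes \<Phi> F :: "nat \<Rightarrow> real"
  assumes q: "q > 0" and rec: "\<And>t. \<Phi> (Suc t) \<le> q * \<Phi> t - c * F t + B"
    and \<Phi>: "\<And>t. \<Phi> t \<ge> 0" and c: "c > 0" and T: "T \<ge> 1"
  shows "(\<Sum>t<T. 1 / q ^ t / (\<Sum>i<T. 1 / q ^ i) * F t) \<le> q ^ T * \<Phi> 0 / c + B / c"
proof -
  define W where "W = (\<Sum>i<T. 1 / q ^ i)"
  have "1 / q ^ (T - 1) \<le> W"
    unfolding W_def using q T by (intro member_le_sum) auto
  moreover have "1 / q ^ (T - 1) = q / q ^ T" using q T by (cases T) auto
  ultimately have W: "q / q ^ T \<le> W" by simp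
  have "0 < q / q ^ T" using q by simp
  with W have W0: "W > 0" by linarith
  have "q * \<Phi> 0 / W \<le> q * \<Phi> 0 / (q / q ^ T)"
    using W q \<Phi>[of 0] \<open>0 < q / q ^ T\<close> W0 by (intro divide_left_mono mult_nonneg_nonneg mult_pos_pos) auto
  then have 1: "q * \<Phi> 0 / W \<le> q ^ T * \<Phi> 0" using q by (simp add: mult.commute)
  have "0 \<le> q * \<Phi> T / q ^ T" using q \<Phi>[of T] by simp
  then have "c * (\<Sum>t<T. F t / q ^ t) \<le> q * \<Phi> 0 + B * W"
    using weighted_telescope[of q \<Phi> c F B T, OF q rec] by (simp add: W_def)
  then have "c * (\<Sum>t<T. F t / q ^ t) / W \<le> (q * \<Phi> 0 + B * W) / W"
    using W0 by (intro divide_right_mono) auto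
  also have "\<dots> = q * \<Phi> 0 / W + B" using W0 by (simp add: add_divide_distrib)
  finally have "c * ((\<Sum>t<T. F t / q ^ t) / W) \<le> q ^ T * \<Phi> 0 + B" using 1 by simp
  then have "(\<Sum>t<T. F t / q ^ t) / W \<le> (q ^ T * \<Phi> 0 + B) / c"
    using c by (simp add: pos_le_divide_eq mult.commute)
  moreover have "(\<Sum>t<T. 1 / q ^ t / W * F t) = (\<Sum>t<T. F t / q ^ t) / W"
    by (simp add: sum_divide_distrib mult.commute)
  ultimately show ?thesis by (simp add: W_def add_divide_distrib)
qed

lemma uniform_average_bound:
  fixes \<Phi> F :: "nat \<Rightarrow> real" and c :: real and T :: nat
  assumes "\<And>t. \<Phi> (Suc t) \<le> \<Phi> t - c * F t + B" "\<And>t. \<Phi> t \<ge> 0" "c > 0" "T \<ge> 1"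
  shows "(\<Sum>t<T. 1 / T * F t) \<le> \<Phi> 0 / (c * T) + B / c"
proof -
  have "c * (\<Sum>t<T. F t) + \<Phi> T \<le> \<Phi> 0 + B * T"
    using weighted_telescope[of 1 \<Phi> c F B T] assms(1) by simp
  then have "c * (\<Sum>t<T. F t) \<le> \<Phi> 0 + B * T" using assms(2)[of T] by linarith
  then have "c * (\<Sum>t<T. F t) / (c * T) \<le> (\<Phi> 0 + B * T) / (c * T)"
    using assms(3) by (intro divide_right_mono) auto
  then show ?thesis
    using assms(3,4) by (simp add: add_divide_distrib sum_divide_distrib[symmetric])
qed

text \<open>\<open>embed_pmf\<close> is known to return the given weights only once they are shown
  to be nonnegative with total mass 1.\<close>

lemma pmf_geometric_index:
  assumes "q > 0" "T \<ge> 1"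
  shows "pmf (geometric_index q T) t = (if t < T then (1 / q ^ t) / (\<Sum>i<T. 1 / q ^ i) else 0)"
  unfolding geometric_index_def
proof (rule pmf_embed_pmf)
  let ?w = "\<lambda>t. if t < T then (1 / q ^ t) / (\<Sum>i<T. 1 / q ^ i) else (0::real)"
  have W: "(\<Sum>i<T. 1 / q ^ i) > 0" using assms by (intro sum_pos) (auto simp: lessThan_empty_iff)
  show w0: "0 \<le> ?w t" for t using assms W by (auto intro!: divide_nonneg_pos)
  have "(\<integral>\<^sup>+t. ennreal (?w t) \<partial>count_space UNIV) = (\<integral>\<^sup>+t. ennreal (?w t) \<partial>count_space {..<T})"
    by (rule nn_integral_count_space_eq) (auto split: if_splits)
  also have "\<dots> = (\<Sum>t<T. ennreal (?w t))" by (rule nn_integral_count_space_finite) simp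
  also have "\<dots> = ennreal (\<Sum>t<T. ?w t)" using w0 by (rule sum_ennreal)
  also have "(\<Sum>t<T. ?w t) = (\<Sum>t<T. 1 / q ^ t / (\<Sum>i<T. 1 / q ^ i))"
    by (rule sum.cong) auto
  also have "\<dots> = (\<Sum>t<T. 1 / q ^ t) / (\<Sum>i<T. 1 / q ^ i)"
    by (rule sum_divide_distrib[symmetric])
  also have "\<dots> = 1" using W by simp
  finally show "(\<integral>\<^sup>+t. ennreal (?w t) \<partial>count_space UNIV) = 1" by simp
qed

lemma pmf_uniform_index:
  assumes "T \<ge> 1"
  shows "pmf (uniform_index T) t = (if t < T then 1 / T else 0)"
  using assms by (subst pmf_of_set) (auto simp: indicator_def lessThan_empty_iff)

text \<open>The index has finite support, so integrability of each \<open>h t\<close> yields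
  integrability on the product, and Fubini reduces the expectation to a finite weighted sum.\<close>

lemma expectation_out_leI:
  assumes P: "prob_space P" and int: "\<And>t. integrable P (h t)"
    and supp: "set_pmf p \<subseteq> {..<T}"
    and le: "(\<Sum>t<T. pmf p t * (\<integral>\<omega>. h t \<omega> \<partial>P)) \<le> B"
  shows "expectation_out_le p P h B"
proof -
  interpret P: prob_space P by fact
  interpret pair_sigma_finite "measure_pmf p" P by unfold_locales
  have fin: "finite (set_pmf p)" using supp by (rule finite_subset) simp
  \<comment> \<open>The index type is countable with the discrete sigma-algebra, so measurability
    for each fixed \<open>t\<close> suffices.\<close>
  have "(\<lambda>(t, \<omega>). h t \<omega>) \<in> borel_measurable (count_space UNIV \<Otimes>\<^sub>M P)"
    using int by (intro measurable_pair_measure_countable1) auto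
  then have m: "(\<lambda>(t, \<omega>). h t \<omega>) \<in> borel_measurable (measure_pmf p \<Otimes>\<^sub>M P)"
    by (subst measurable_cong_sets[OF sets_pair_measure_cong[OF sets_measure_pmf_count_space refl] refl])
  have i: "integrable (measure_pmf p \<Otimes>\<^sub>M P) (\<lambda>(t, \<omega>). h t \<omega>)"
    using m fin int by (intro Fubini_integrable integrable_measure_pmf_finite) auto
  have "(\<integral>(t, \<omega>). h t \<omega> \<partial>(measure_pmf p \<Otimes>\<^sub>M P)) = (\<integral>t. \<integral>\<omega>. h t \<omega> \<partial>P \<partial>measure_pmf p)"
    using integral_fst'[OF i] by simp
  also have "\<dots> = (\<Sum>t<T. pmf p t * (\<integral>\<omega>. h t \<omega> \<partial>P))"
    by (subst integral_measure_pmf[of "{..<T}"]) (use supp in auto)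
  finally show ?thesis using i le by (simp add: expectation_out_le_def)
qed

text \<open>The uncapped choice balances the two terms, each being \<open>sqrt (c * r0 / T)\<close>.
  When the cap is active the first term equals \<open>D * r0 / T\<close>, and the second does not
  exceed its balanced value because \<open>\<gamma>\<close> lies below the balanced step size (it is
  0 if \<open>c = 0\<close>). The value \<open>\<gamma> = 0\<close> is kept apart because the
  quotient would then be 0 by convention.\<close>

lemma stepsize_B_tuned:
  assumes "c \<ge> 0" "r0 \<ge> 0" "D > 0" "T \<ge> 1"
  defines "\<gamma> \<equiv> stepsize_B c r0 D T"
  shows "0 \<le> \<gamma>" "\<gamma> \<le> 1 / D"
    and "\<gamma> = 0 \<Longrightarrow> r0 = 0"
    and "\<gamma> > 0 \<Longrightarrow> r0 / (\<gamma> * T) + c * \<gamma> \<le> D * r0 / T + 2 * sqrt (c * r0 / T)"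
proof -
  have T0: "real T > 0" using assms by simp
  show "0 \<le> \<gamma>" "\<gamma> \<le> 1 / D"
    using assms by (auto simp: \<gamma>_def stepsize_B_def)
  show "r0 = 0" if "\<gamma> = 0"
    using that assms by (auto simp: \<gamma>_def stepsize_B_def split: if_splits)
  assume \<gamma>: "\<gamma> > 0"
  let ?s = "sqrt (r0 / (c * real T))"
  have cs: "c * ?s = sqrt (c * r0 / T)" if "c > 0"
  proof -
    have "c * ?s = sqrt (c\<^sup>2) * ?s" using that by simp
    also have "\<dots> = sqrt (c\<^sup>2 * (r0 / (c * real T)))" by (simp only: real_sqrt_mult)
    also have "c\<^sup>2 * (r0 / (c * real T)) = c * r0 / T" using that by (simp add: power2_eq_square)
    finally show ?thesis .
  qed
  show "r0 / (\<gamma> * T) + c * \<gamma> \<le> D * r0 / T + 2 * sqrt (c * r0 / T)"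
  proof (cases "c \<noteq> 0 \<and> ?s \<le> 1 / D")
    case True
    then have g: "\<gamma> = ?s" and c: "c > 0" using assms by (auto simp: \<gamma>_def stepsize_B_def)
    have "\<gamma> * \<gamma> = r0 / (c * T)" unfolding g using assms c by (simp flip: power2_eq_square)
    then have "r0 = c * \<gamma> * (\<gamma> * T)" using c T0 by (simp add: field_simps)
    then have "r0 / (\<gamma> * T) = c * \<gamma>" using \<gamma> T0 by simp
    then have "r0 / (\<gamma> * T) + c * \<gamma> = 2 * sqrt (c * r0 / T)" using cs[OF c] g by simp
    moreover have "0 \<le> D * r0 / T" using assms by simp
    ultimately show ?thesis by simp
  next
    case False
    then have g: "\<gamma> = 1 / D" by (auto simp: \<gamma>_def stepsize_B_def)
    have "c * \<gamma> \<le> sqrt (c * r0 / T)"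
    proof (cases "c = 0")
      case c: False
      then have "\<gamma> \<le> ?s" using False g by simp
      then have "c * \<gamma> \<le> c * ?s" using assms by (intro mult_left_mono) auto
      then show ?thesis using cs c assms by simp
    qed simp
    moreover have "0 \<le> sqrt (c * r0 / T)" using assms by simp
    moreover have "r0 / (\<gamma> * T) = D * r0 / T" using g by simp
    ultimately show ?thesis by linarith
  qed
qed

subsection \<open>Error-compensated SGD\<close>

lemma (in smooth_function) square_integrable_grad:
  assumes "prob_space P" "square_integrable P X"
  shows "square_integrable P (\<lambda>\<omega>. grad (X \<omega>))"
proof -
  interpret prob_space P by fact
  note [measurable] = square_integrableD(1)[OF assms(2)]
  have "integrable P (\<lambda>\<omega>. 2 * (norm (grad 0))\<^sup>2 + 2 * L\<^sup>2 * (norm (X \<omega>))\<^sup>2)"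
    using square_integrableD(2)[OF assms(2)] by simp
  then have "integrable P (\<lambda>\<omega>. (norm (grad (X \<omega>)))\<^sup>2)"
    by (rule Bochner_Integration.integrable_bound) (use norm_grad_add_sq_le[of 0] in auto)
  then show ?thesis by (simp add: square_integrable_def)
qed

text \<open>\<open>f - fmin\<close> lies between 0 and the quadratic upper model at the
  origin.\<close>

lemma (in smooth_function) integrable_f:
  assumes "prob_space P" "square_integrable P X"
  shows "integrable P (\<lambda>\<omega>. f (X \<omega>))"
proof -
  interpret prob_space P by fact
  note [measurable] = square_integrableD(1)[OF assms(2)]
  have i: "integrable P (\<lambda>\<omega>. f 0 - fmin + grad 0 \<bullet> X \<omega> + L / 2 * (norm (X \<omega>))\<^sup>2)"
    using square_integrableD(2)[OF assms(2)]
      square_integrable_inner[OF square_integrable_const assms(2)] by simp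
  have "integrable P (\<lambda>\<omega>. f (X \<omega>) - fmin)"
    using fmin_le f_le[of _ 0]
    by (intro Bochner_Integration.integrable_bound[OF i])
      (auto intro!: AE_I2 order.trans[OF _ abs_ge_self] simp: add.assoc)
  then have "integrable P (\<lambda>\<omega>. f (X \<omega>) - fmin + fmin)" by (rule Bochner_Integration.integrable_add) simp
  then show ?thesis by simp
qed

locale error_compensated_sgd = smooth_function f grad fmin L
  for f :: "'a::euclidean_space \<Rightarrow> real" and grad fmin L +
  fixes M \<sigma> \<delta> :: real and S :: "'s measure" and C :: "'a \<Rightarrow> 's \<Rightarrow> 'a" and x0 :: 'a and \<gamma> :: real
    and P :: "'w measure" and \<xi> :: "nat \<Rightarrow> 'w \<Rightarrow> 'a" and s :: "nat \<Rightarrow> 'w \<Rightarrow> 's"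
    and x e g v :: "nat \<Rightarrow> 'w \<Rightarrow> 'a"
  assumes M_nonneg: "M \<ge> 0"
    and \<delta>_pos: "\<delta> > 0"
    and compressor: "approx_compressor \<delta> S C"
    and run: "ec_sgd_run M \<sigma> grad S C x0 \<gamma> P \<xi> s x e g v"
    and \<gamma>_nonneg: "\<gamma> \<ge> 0"

sublocale error_compensated_sgd \<subseteq> prob_space P
  using run by (simp add: ec_sgd_run_def)

context error_compensated_sgd
begin

section \<open>Measurability and square integrability of the iterates\<close>

lemma \<delta>_le_1: "\<delta> \<le> 1"
  using compressor by (rule approx_compressor_delta_le_1)

lemma start: "\<omega> \<in> space P \<Longrightarrow> x 0 \<omega> = x0" "\<omega> \<in> space P \<Longrightarrow> e 0 \<omega> = 0"
  using run by (auto simp: ec_sgd_run_def)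

lemma step:
  assumes "\<omega> \<in> space P"
  shows "g t \<omega> = grad (x t \<omega>) + \<xi> t \<omega>"
    and "e (Suc t) \<omega> = e t \<omega> + \<gamma> *\<^sub>R g t \<omega> - C (e t \<omega> + \<gamma> *\<^sub>R g t \<omega>) (s t \<omega>)"
    and "x (Suc t) \<omega> = x t \<omega> - C (e t \<omega> + \<gamma> *\<^sub>R g t \<omega>) (s t \<omega>)"
  using run assms by (simp_all add: ec_sgd_run_def)

lemma bounded_noise: "bounded_noise M \<sigma> grad P (history P S \<xi> s t t) (x t) (\<xi> t)"
  and fresh_seed: "fresh_seed P S (history P S \<xi> s (Suc t) t) (s t)"
  using run by (simp_all add: ec_sgd_run_def)

lemma noise_measurable [measurable]: "\<xi> t \<in> borel_measurable P"
  using bounded_noise[of t] by (simp add: bounded_noise_def)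

lemma seed_measurable [measurable]: "s t \<in> measurable P S"
  using fresh_seed[of t] by (simp add: fresh_seed_def)

lemma subalgebra_hist: "subalgebra P (history P S \<xi> s m n)"
  by (rule subalgebra_history) (rule noise_measurable seed_measurable)+

text \<open>The two indices differ because \<open>g t\<close> already involves noise
  \<open>t\<close> but not yet seed \<open>t\<close>: this is exactly the past from which the seed
  of step \<open>t\<close> is independent.\<close>

lemma g_adapted:
  assumes "x t \<in> borel_measurable (history P S \<xi> s t t)"
  shows "g t \<in> borel_measurable (history P S \<xi> s (Suc t) t)"
proof -
  have [measurable]: "x t \<in> borel_measurable (history P S \<xi> s (Suc t) t)"
    using assms by (rule measurable_history_mono) auto
  have [measurable]: "\<xi> t \<in> borel_measurable (history P S \<xi> s (Suc t) t)"
    by (rule measurable_history_noise) simp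
  have "(\<lambda>\<omega>. grad (x t \<omega>) + \<xi> t \<omega>) \<in> borel_measurable (history P S \<xi> s (Suc t) t)"
    by measurable
  then show ?thesis by (rule measurable_cong[THEN iffD1, rotated]) (simp add: step(1))
qed

text \<open>The equations of the run hold only on \<open>space P\<close>, so measurability is shown
  for their right-hand sides and transferred. The deterministic start makes the empty history
  sufficient at time 0.\<close>

lemma x_e_adapted:
  "x t \<in> borel_measurable (history P S \<xi> s t t) \<and> e t \<in> borel_measurable (history P S \<xi> s t t)"
proof (induction t)
  case 0
  have "x 0 \<in> borel_measurable (history P S \<xi> s 0 0) \<longleftrightarrow> (\<lambda>_. x0) \<in> borel_measurable (history P S \<xi> s 0 0)"
    "e 0 \<in> borel_measurable (history P S \<xi> s 0 0) \<longleftrightarrow> (\<lambda>_. 0 :: 'a) \<in> borel_measurable (history P S \<xi> s 0 0)"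
    by (intro measurable_cong; simp add: start)+
  then show ?case by simp
next
  case (Suc t)
  let ?H = "history P S \<xi> s (Suc t) (Suc t)"
  have [measurable]: "x t \<in> borel_measurable ?H" "e t \<in> borel_measurable ?H"
    using Suc by (auto intro: measurable_history_mono[of _ P S \<xi> s t t])
  have [measurable]: "g t \<in> borel_measurable ?H"
    by (rule measurable_history_mono[OF g_adapted]) (use Suc in auto)
  have [measurable]: "s t \<in> measurable ?H S"
    by (rule measurable_history_seed) (auto intro: seed_measurable)
  have Cm: "(\<lambda>(x, s). C x s) \<in> borel_measurable (borel \<Otimes>\<^sub>M S)"
    using compressor by (simp add: approx_compressor_def)
  have [measurable]: "(\<lambda>\<omega>. C (e t \<omega> + \<gamma> *\<^sub>R g t \<omega>) (s t \<omega>)) \<in> borel_measurable ?H"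
    using measurable_compose[OF _ Cm, of "\<lambda>\<omega>. (e t \<omega> + \<gamma> *\<^sub>R g t \<omega>, s t \<omega>)" ?H] by simp
  have "x (Suc t) \<in> borel_measurable ?H \<longleftrightarrow>
      (\<lambda>\<omega>. x t \<omega> - C (e t \<omega> + \<gamma> *\<^sub>R g t \<omega>) (s t \<omega>)) \<in> borel_measurable ?H"
    "e (Suc t) \<in> borel_measurable ?H \<longleftrightarrow>
      (\<lambda>\<omega>. e t \<omega> + \<gamma> *\<^sub>R g t \<omega> - C (e t \<omega> + \<gamma> *\<^sub>R g t \<omega>) (s t \<omega>)) \<in> borel_measurable ?H"
    by (intro measurable_cong; simp add: step)+
  then show ?case by simp
qed

lemma x_measurable [measurable]: "x t \<in> borel_measurable P"
  and e_measurable [measurable]: "e t \<in> borel_measurable P"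
  using x_e_adapted[of t] by (blast intro: measurable_from_subalg[OF subalgebra_hist])+

lemma square_integrable_noise:
  assumes "square_integrable P (x t)"
  shows "square_integrable P (\<xi> t)"
    and "expectation (\<lambda>\<omega>. (norm (\<xi> t \<omega>))\<^sup>2) \<le> M * expectation (\<lambda>\<omega>. (norm (grad (x t \<omega>)))\<^sup>2) + \<sigma>\<^sup>2"
  using bounded_noise_second_moment[OF bounded_noise M_nonneg x_measurable square_integrable_grad[OF prob_space_axioms assms]]
  by auto

lemma square_integrable_gradient_estimate:
  assumes "square_integrable P (x t)"
  shows "square_integrable P (g t)"
  using square_integrable_add[OF square_integrable_grad[OF prob_space_axioms assms] square_integrable_noise(1)[OF assms]]
  by (subst square_integrable_cong[OF step(1)])

lemma compression_step:
  assumes "square_integrable P (x t)" "square_integrable P (e t)"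
  shows "square_integrable P (e (Suc t))"
    and "expectation (\<lambda>\<omega>. (norm (e (Suc t) \<omega>))\<^sup>2) \<le> (1 - \<delta>) * expectation (\<lambda>\<omega>. (norm (e t \<omega> + \<gamma> *\<^sub>R g t \<omega>))\<^sup>2)"
proof -
  let ?H = "history P S \<xi> s (Suc t) t"
  have [measurable]: "g t \<in> borel_measurable ?H" "e t \<in> borel_measurable ?H"
    using x_e_adapted[of t] by (auto intro: g_adapted measurable_history_mono[of _ P S \<xi> s t t])
  have y: "(\<lambda>\<omega>. e t \<omega> + \<gamma> *\<^sub>R g t \<omega>) \<in> borel_measurable ?H" by measurable
  have y2: "square_integrable P (\<lambda>\<omega>. e t \<omega> + \<gamma> *\<^sub>R g t \<omega>)"
    by (intro square_integrable_add square_integrable_scaleR square_integrable_gradient_estimate assms)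
  note ce = compressor_error[OF compressor fresh_seed subalgebra_hist y y2]
  show "square_integrable P (e (Suc t))"
    using ce(1) by (subst square_integrable_cong[OF step(2)])
  have "expectation (\<lambda>\<omega>. (norm (e (Suc t) \<omega>))\<^sup>2) =
      expectation (\<lambda>\<omega>. (norm (e t \<omega> + \<gamma> *\<^sub>R g t \<omega> - C (e t \<omega> + \<gamma> *\<^sub>R g t \<omega>) (s t \<omega>)))\<^sup>2)"
    by (intro Bochner_Integration.integral_cong) (simp_all add: step)
  then show "expectation (\<lambda>\<omega>. (norm (e (Suc t) \<omega>))\<^sup>2) \<le> (1 - \<delta>) * expectation (\<lambda>\<omega>. (norm (e t \<omega> + \<gamma> *\<^sub>R g t \<omega>))\<^sup>2)"
    using ce(2) by simp
qed

lemma virtual_step: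
  "\<omega> \<in> space P \<Longrightarrow> x (Suc t) \<omega> - e (Suc t) \<omega> = (x t \<omega> - e t \<omega>) + (- \<gamma>) *\<^sub>R g t \<omega>"
  by (simp add: step(2,3))

text \<open>What the compressor bound controls directly is the error, not the output of
  \<open>C\<close>. Hence \<open>x (Suc t)\<close> is recovered as the virtual iterate plus the new
  error. Both claims go through one induction, since the new error needs the gradient at
  \<open>x t\<close>.\<close>

lemma square_integrable_x_e: "square_integrable P (x t) \<and> square_integrable P (e t)"
proof (induction t)
  case 0
  show ?case
    by (simp add: square_integrable_cong[OF start(1)] square_integrable_cong[OF start(2)] square_integrable_const)
next
  case (Suc t)
  then have e: "square_integrable P (e (Suc t))" by (intro compression_step) auto
  have "square_integrable P (\<lambda>\<omega>. (x t \<omega> - e t \<omega>) + (- \<gamma>) *\<^sub>R g t \<omega> + e (Suc t) \<omega>)"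
    using Suc e by (intro square_integrable_add square_integrable_diff square_integrable_scaleR
        square_integrable_gradient_estimate) auto
  moreover have "x (Suc t) \<omega> = (x t \<omega> - e t \<omega>) + (- \<gamma>) *\<^sub>R g t \<omega> + e (Suc t) \<omega>" if "\<omega> \<in> space P" for \<omega>
    using virtual_step[OF that, of t] by (simp add: algebra_simps)
  ultimately show ?case using e square_integrable_cong[of P "x (Suc t)"] by simp
qed

lemma square_integrable_iterates:
  "square_integrable P (x t)" "square_integrable P (e t)" "square_integrable P (g t)"
  "square_integrable P (\<xi> t)" "square_integrable P (\<lambda>\<omega>. grad (x t \<omega>))"
  "square_integrable P (\<lambda>\<omega>. x t \<omega> - e t \<omega>)" "square_integrable P (\<lambda>\<omega>. grad (x t \<omega> - e t \<omega>))"
proof -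
  show xe: "square_integrable P (x t)" "square_integrable P (e t)"
    using square_integrable_x_e by auto
  then show xd: "square_integrable P (\<lambda>\<omega>. x t \<omega> - e t \<omega>)" by (rule square_integrable_diff)
  show "square_integrable P (g t)" using xe(1) by (rule square_integrable_gradient_estimate)
  show "square_integrable P (\<xi> t)" using xe(1) by (rule square_integrable_noise)
  show "square_integrable P (\<lambda>\<omega>. grad (x t \<omega>))"
    using prob_space_axioms xe(1) by (rule square_integrable_grad)
  show "square_integrable P (\<lambda>\<omega>. grad (x t \<omega> - e t \<omega>))"
    using prob_space_axioms xd by (rule square_integrable_grad)
qed

section \<open>Mean energies and their one-step bounds\<close>

definition "err t = expectation (\<lambda>\<omega>. (norm (e t \<omega>))\<^sup>2)"
definition "grad_sq t = expectation (\<lambda>\<omega>. (norm (grad (x t \<omega>)))\<^sup>2)"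
definition "gap t = expectation (\<lambda>\<omega>. f (x t \<omega>) - fmin)"

lemma err_nonneg: "0 \<le> err t" and grad_sq_nonneg: "0 \<le> grad_sq t" and gap_nonneg: "0 \<le> gap t"
  using fmin_le by (simp_all add: err_def grad_sq_def gap_def)

lemma err_0: "err 0 = 0"
proof -
  have "err 0 = expectation (\<lambda>\<omega>. 0)"
    unfolding err_def by (intro Bochner_Integration.integral_cong) (simp_all add: start)
  then show ?thesis by simp
qed

lemma grad_sq_le_gap: "grad_sq t \<le> 2 * L * gap t"
proof -
  have "grad_sq t \<le> expectation (\<lambda>\<omega>. 2 * L * (f (x t \<omega>) - fmin))"
    unfolding grad_sq_def
    by (intro integral_mono norm_grad_sq_le)
      (auto intro!: integrable_f square_integrable_iterates square_integrableD(2) prob_space_axioms)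
  then show ?thesis by (simp add: gap_def)
qed

lemma expectation_inner_noise:
  assumes "Y \<in> borel_measurable (history P S \<xi> s t t)" "square_integrable P Y"
  shows "expectation (\<lambda>\<omega>. Y \<omega> \<bullet> \<xi> t \<omega>) = 0"
  by (rule bounded_noise_orthogonal[OF bounded_noise x_measurable square_integrable_iterates(4)
        subalgebra_hist assms])

lemma expectation_inner_gradient_estimate:
  assumes "Y \<in> borel_measurable (history P S \<xi> s t t)" "square_integrable P Y"
  shows "expectation (\<lambda>\<omega>. Y \<omega> \<bullet> g t \<omega>) = expectation (\<lambda>\<omega>. Y \<omega> \<bullet> grad (x t \<omega>))"
proof -
  have "expectation (\<lambda>\<omega>. Y \<omega> \<bullet> g t \<omega>) = expectation (\<lambda>\<omega>. Y \<omega> \<bullet> grad (x t \<omega>) + Y \<omega> \<bullet> \<xi> t \<omega>)"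
    by (intro Bochner_Integration.integral_cong) (simp_all add: step inner_add_right)
  then show ?thesis
    using assms by (simp add: square_integrable_inner square_integrable_iterates expectation_inner_noise)
qed

text \<open>The noise is orthogonal to everything determined by the past, so it contributes only its
  own second moment. This serves the error (\<open>Y = e t\<close>, \<open>c = \<gamma>\<close>) as
  well as the plain second moment of \<open>g t\<close> (\<open>Y = 0\<close>,
  \<open>c = 1\<close>).\<close>

lemma expectation_add_gradient_estimate:
  assumes "Y \<in> borel_measurable (history P S \<xi> s t t)" "square_integrable P Y"
  shows "expectation (\<lambda>\<omega>. (norm (Y \<omega> + c *\<^sub>R g t \<omega>))\<^sup>2)
    \<le> expectation (\<lambda>\<omega>. (norm (Y \<omega> + c *\<^sub>R grad (x t \<omega>)))\<^sup>2) + c\<^sup>2 * (M * grad_sq t + \<sigma>\<^sup>2)"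
proof -
  define Z where "Z = (\<lambda>\<omega>. Y \<omega> + c *\<^sub>R grad (x t \<omega>))"
  have [measurable]: "x t \<in> borel_measurable (history P S \<xi> s t t)" using x_e_adapted by simp
  note [measurable] = assms(1)
  have Z: "Z \<in> borel_measurable (history P S \<xi> s t t)" "square_integrable P Z"
    unfolding Z_def by (measurable, intro square_integrable_add square_integrable_scaleR
        square_integrable_iterates assms)
  have "expectation (\<lambda>\<omega>. (norm (Y \<omega> + c *\<^sub>R g t \<omega>))\<^sup>2) = expectation (\<lambda>\<omega>. (norm (Z \<omega> + c *\<^sub>R \<xi> t \<omega>))\<^sup>2)"
    by (intro Bochner_Integration.integral_cong) (simp_all add: step Z_def scaleR_add_right add.assoc)
  also have "\<dots> = expectation (\<lambda>\<omega>. (norm (Z \<omega>))\<^sup>2) + c\<^sup>2 * expectation (\<lambda>\<omega>. (norm (\<xi> t \<omega>))\<^sup>2)"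
    using expectation_norm_add_sq[OF Z(2) square_integrable_scaleR[OF square_integrable_iterates(4)]]
    by (simp add: expectation_inner_noise[OF Z] power_mult_distrib)
  also have "\<dots> \<le> expectation (\<lambda>\<omega>. (norm (Z \<omega>))\<^sup>2) + c\<^sup>2 * (M * grad_sq t + \<sigma>\<^sup>2)"
    unfolding grad_sq_def
    by (intro add_left_mono mult_left_mono square_integrable_noise square_integrable_iterates) simp
  finally show ?thesis by (simp add: Z_def)
qed

text \<open>The noise is split off before Young's inequality is applied. Being orthogonal to the
  past it costs no Young factor, so only the exact gradient carries \<open>2 / \<delta>\<close>,
  while \<open>M\<close> and \<open>\<sigma>\<^sup>2\<close> enter with coefficient 1.\<close>

lemma err_Suc: "err (Suc t) \<le> (1 - \<delta> / 2) * err t + \<gamma>\<^sup>2 * ((2 / \<delta> + M) * grad_sq t + \<sigma>\<^sup>2)"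
proof -
  have eh: "e t \<in> borel_measurable (history P S \<xi> s t t)" using x_e_adapted by simp
  have "err (Suc t) \<le> (1 - \<delta>) * expectation (\<lambda>\<omega>. (norm (e t \<omega> + \<gamma> *\<^sub>R g t \<omega>))\<^sup>2)"
    unfolding err_def by (intro compression_step square_integrable_iterates)
  also have "\<dots> \<le> (1 - \<delta>) * (expectation (\<lambda>\<omega>. (norm (e t \<omega> + \<gamma> *\<^sub>R grad (x t \<omega>)))\<^sup>2) + \<gamma>\<^sup>2 * (M * grad_sq t + \<sigma>\<^sup>2))"
    using \<delta>_le_1 by (intro mult_left_mono expectation_add_gradient_estimate eh square_integrable_iterates) auto
  also have "\<dots> = expectation (\<lambda>\<omega>. (1 - \<delta>) * (norm (e t \<omega> + \<gamma> *\<^sub>R grad (x t \<omega>)))\<^sup>2) + (1 - \<delta>) * (\<gamma>\<^sup>2 * (M * grad_sq t + \<sigma>\<^sup>2))"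
    by (simp add: distrib_left)
  also have "\<dots> \<le> expectation (\<lambda>\<omega>. (1 - \<delta> / 2) * (norm (e t \<omega>))\<^sup>2 + 2 / \<delta> * (norm (\<gamma> *\<^sub>R grad (x t \<omega>)))\<^sup>2)
      + 1 * (\<gamma>\<^sup>2 * (M * grad_sq t + \<sigma>\<^sup>2))"
  proof (intro add_mono integral_mono mult_right_mono)
    show "integrable P (\<lambda>\<omega>. (1 - \<delta>) * (norm (e t \<omega> + \<gamma> *\<^sub>R grad (x t \<omega>)))\<^sup>2)"
      by (intro integrable_mult_right square_integrableD square_integrable_add square_integrable_scaleR
          square_integrable_iterates)
    show "integrable P (\<lambda>\<omega>. (1 - \<delta> / 2) * (norm (e t \<omega>))\<^sup>2 + 2 / \<delta> * (norm (\<gamma> *\<^sub>R grad (x t \<omega>)))\<^sup>2)"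
      by (intro Bochner_Integration.integrable_add integrable_mult_right square_integrableD square_integrable_scaleR
          square_integrable_iterates)
    show "0 \<le> \<gamma>\<^sup>2 * (M * grad_sq t + \<sigma>\<^sup>2)" using M_nonneg grad_sq_nonneg[of t] by simp
    show "(1 - \<delta>) * (norm (e t \<omega> + \<gamma> *\<^sub>R grad (x t \<omega>)))\<^sup>2
        \<le> (1 - \<delta> / 2) * (norm (e t \<omega>))\<^sup>2 + 2 / \<delta> * (norm (\<gamma> *\<^sub>R grad (x t \<omega>)))\<^sup>2" for \<omega>
      by (rule contraction_norm_add_sq_le[OF \<delta>_pos \<delta>_le_1])
  qed (use \<delta>_pos in auto)
  also have "expectation (\<lambda>\<omega>. (1 - \<delta> / 2) * (norm (e t \<omega>))\<^sup>2 + 2 / \<delta> * (norm (\<gamma> *\<^sub>R grad (x t \<omega>)))\<^sup>2)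
      = (1 - \<delta> / 2) * err t + 2 / \<delta> * (\<gamma>\<^sup>2 * grad_sq t)"
    by (simp add: square_integrableD square_integrable_iterates power_mult_distrib err_def grad_sq_def)
  finally show ?thesis by (simp add: algebra_simps)
qed

lemma second_moment_gradient_estimate:
  "expectation (\<lambda>\<omega>. (norm (g t \<omega>))\<^sup>2) \<le> (1 + M) * grad_sq t + \<sigma>\<^sup>2"
  using expectation_add_gradient_estimate[of "\<lambda>_. 0" t 1] square_integrable_const[of "0 :: 'a"]
  by (simp add: grad_sq_def algebra_simps)

text \<open>\<open>a\<close> is 2 in the quasi-convex case and 1 in the non-convex case. The third
  bound controls the second moment of \<open>g t\<close> and holds because
  \<open>\<delta> \<le> 1\<close> gives \<open>1 \<le> a / \<delta>\<close>.\<close>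

lemma stepsize_bounds:
  assumes "\<gamma> \<le> 1 / (10 * L * (a / \<delta> + M))" "a > 0"
  shows "\<gamma> * L * (a / \<delta> + M) \<le> 1 / 10" and "\<gamma> * L * a \<le> \<delta> / 10"
    and "a \<ge> 1 \<Longrightarrow> \<gamma> * L * (1 + M) \<le> 1 / 10"
proof -
  have K: "a / \<delta> + M > 0" using assms(2) \<delta>_pos M_nonneg by (intro add_pos_nonneg) auto
  then have "\<gamma> * (10 * L * (a / \<delta> + M)) \<le> 1"
    using assms(1) L_pos by (simp add: pos_le_divide_eq)
  moreover have "\<gamma> * (10 * L * k) = 10 * (\<gamma> * L * k)" for k by simp
  ultimately show 1: "\<gamma> * L * (a / \<delta> + M) \<le> 1 / 10" by (metis le_divide_eq_numeral1(1) mult.commute)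
  have "\<gamma> * L * (a / \<delta>) \<le> \<gamma> * L * (a / \<delta> + M)"
    using \<gamma>_nonneg L_pos M_nonneg by (intro mult_left_mono) auto
  with 1 have "\<gamma> * L * (a / \<delta>) \<le> 1 / 10" by linarith
  then show "\<gamma> * L * a \<le> \<delta> / 10" using \<delta>_pos by (simp add: field_simps)
  assume "a \<ge> 1"
  then have "1 \<le> a / \<delta>" using \<delta>_pos \<delta>_le_1 by (simp add: le_divide_eq)
  then have "\<gamma> * L * (1 + M) \<le> \<gamma> * L * (a / \<delta> + M)"
    using \<gamma>_nonneg L_pos by (intro mult_left_mono) auto
  with 1 show "\<gamma> * L * (1 + M) \<le> 1 / 10" by linarith
qed

section \<open>The quasi-convex case\<close>

definition "vdist xs t = expectation (\<lambda>\<omega>. (norm (x t \<omega> - e t \<omega> - xs))\<^sup>2)"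

lemma vdist_nonneg: "0 \<le> vdist xs t"
  by (simp add: vdist_def)

lemma vdist_0: "vdist xs 0 = (norm (x0 - xs))\<^sup>2"
proof -
  have "vdist xs 0 = expectation (\<lambda>\<omega>. (norm (x0 - xs))\<^sup>2)"
    unfolding vdist_def by (intro Bochner_Integration.integral_cong) (simp_all add: start)
  then show ?thesis by (simp add: prob_space)
qed

text \<open>Here \<open>y\<close> stands for the query point and \<open>d\<close> for the error.
  Young's weight \<open>1 / (4 * L)\<close> makes the squared gradient cost exactly half of the gap,
  leaving \<open>2 - 1 / 2 = 3 / 2\<close>. The coefficient \<open>6 * L\<close> is
  \<open>4 * L\<close> from Young plus \<open>2 * L\<close>, a bound for the \<open>\<mu>\<close>
  paid when the quadratic term is moved from \<open>y\<close> to \<open>y - d\<close>.\<close>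

lemma quasi_convex_inner_bound:
  assumes qc: "quasi_convex \<mu> f grad fmin xs" and \<mu>: "\<mu> \<ge> 0"
  shows "- 2 * (grad y \<bullet> (y - d - xs))
    \<le> - (3 / 2) * (f y - fmin) - \<mu> / 2 * (norm (y - d - xs))\<^sup>2 + 6 * L * (norm d)\<^sup>2"
proof -
  have 1: "f y - fmin + (\<mu> * (norm (y - xs))\<^sup>2) / 2 \<le> grad y \<bullet> (y - xs)"
    using qc by (simp add: quasi_convex_def)
  have "(norm ((y - xs) + (- d)))\<^sup>2 \<le> 2 * (norm (y - xs))\<^sup>2 + 2 * (norm (- d))\<^sup>2"
    by (rule norm_add_sq_le)
  then have "\<mu> / 2 * (norm (y - d - xs))\<^sup>2 \<le> \<mu> / 2 * (2 * (norm (y - xs))\<^sup>2 + 2 * (norm d)\<^sup>2)"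
    using \<mu> by (intro mult_left_mono) (auto simp: algebra_simps)
  then have 2: "\<mu> / 2 * (norm (y - d - xs))\<^sup>2 \<le> \<mu> * (norm (y - xs))\<^sup>2 + \<mu> * (norm d)\<^sup>2"
    by (simp add: distrib_left)
  have "\<mu> * (norm d)\<^sup>2 \<le> 2 * L * (norm d)\<^sup>2"
    using quasi_convex_minimizer(3)[OF qc \<mu>] by (intro mult_right_mono) auto
  then have 3: "\<mu> * (norm d)\<^sup>2 \<le> 2 * (L * (norm d)\<^sup>2)" by simp
  have "2 * (grad y \<bullet> d) \<le> 1 / (4 * L) * (norm (grad y))\<^sup>2 + (norm d)\<^sup>2 / (1 / (4 * L))"
    using L_pos by (intro two_inner_le) simp
  then have 4: "2 * (grad y \<bullet> d) \<le> 1 / (4 * L) * (norm (grad y))\<^sup>2 + 4 * (L * (norm d)\<^sup>2)"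
    by (simp add: mult_ac)
  have "1 / (4 * L) * (norm (grad y))\<^sup>2 \<le> 1 / (4 * L) * (2 * L * (f y - fmin))"
    using L_pos norm_grad_sq_le by (intro mult_left_mono) auto
  then have 5: "1 / (4 * L) * (norm (grad y))\<^sup>2 \<le> (f y - fmin) / 2"
    using L_pos by (simp add: field_simps)
  have 6: "grad y \<bullet> (y - d - xs) = grad y \<bullet> (y - xs) - grad y \<bullet> d"
    by (simp add: inner_diff_right)
  \<comment> \<open>With every product replaced by a variable, the combination of the five
    inequalities is linear.\<close>
  have "- 2 * (I - J) \<le> - (3 / 2) * F - m + 6 * l"
    if "F + k / 2 \<le> I" "m \<le> k + n" "n \<le> 2 * l" "2 * J \<le> G + 4 * l" "G \<le> F / 2"
    for F G I J k l m n :: real using that by (simp add: field_simps)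
  from this[OF 1 2 3 4 5] show ?thesis unfolding 6 by (simp only: mult.assoc)
qed

text \<open>In the expanded square, the base point of the virtual step is determined by the past, so
  the cross term sees only the exact gradient and the pointwise bound applies to it.\<close>

lemma vdist_Suc:
  assumes qc: "quasi_convex \<mu> f grad fmin xs" and \<mu>: "\<mu> \<ge> 0"
  shows "vdist xs (Suc t) \<le> (1 - \<mu> * \<gamma> / 2) * vdist xs t - 3 / 2 * \<gamma> * gap t
    + 6 * L * \<gamma> * err t + \<gamma>\<^sup>2 * ((1 + M) * grad_sq t + \<sigma>\<^sup>2)"
proof -
  define Y where "Y = (\<lambda>\<omega>. x t \<omega> - e t \<omega> - xs)"
  have [measurable]: "x t \<in> borel_measurable (history P S \<xi> s t t)"
    "e t \<in> borel_measurable (history P S \<xi> s t t)" using x_e_adapted by auto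
  have Y: "Y \<in> borel_measurable (history P S \<xi> s t t)" "square_integrable P Y"
    unfolding Y_def by (measurable, intro square_integrable_diff square_integrable_iterates square_integrable_const)
  have "vdist xs (Suc t) = expectation (\<lambda>\<omega>. (norm (Y \<omega> + (- \<gamma>) *\<^sub>R g t \<omega>))\<^sup>2)"
    unfolding vdist_def
    by (intro Bochner_Integration.integral_cong) (simp_all add: virtual_step Y_def algebra_simps)
  also have "\<dots> = vdist xs t + 2 * expectation (\<lambda>\<omega>. Y \<omega> \<bullet> ((- \<gamma>) *\<^sub>R g t \<omega>))
      + expectation (\<lambda>\<omega>. (norm ((- \<gamma>) *\<^sub>R g t \<omega>))\<^sup>2)"
    by (subst expectation_norm_add_sq[OF Y(2) square_integrable_scaleR[OF square_integrable_iterates(3)]])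
      (simp add: vdist_def Y_def)
  also have "expectation (\<lambda>\<omega>. (norm ((- \<gamma>) *\<^sub>R g t \<omega>))\<^sup>2) = \<gamma>\<^sup>2 * expectation (\<lambda>\<omega>. (norm (g t \<omega>))\<^sup>2)"
    by (simp add: power_mult_distrib)
  also have "2 * expectation (\<lambda>\<omega>. Y \<omega> \<bullet> ((- \<gamma>) *\<^sub>R g t \<omega>))
      = \<gamma> * (- 2 * expectation (\<lambda>\<omega>. Y \<omega> \<bullet> grad (x t \<omega>)))"
    by (simp add: expectation_inner_gradient_estimate[OF Y])
  also have "- 2 * expectation (\<lambda>\<omega>. Y \<omega> \<bullet> grad (x t \<omega>)) = expectation (\<lambda>\<omega>. - 2 * (grad (x t \<omega>) \<bullet> Y \<omega>))"
    by (simp add: inner_commute)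
  also have "\<dots> \<le> expectation (\<lambda>\<omega>. - (3 / 2) * (f (x t \<omega>) - fmin) - \<mu> / 2 * (norm (Y \<omega>))\<^sup>2
      + 6 * L * (norm (e t \<omega>))\<^sup>2)"
  proof (rule integral_mono)
    show "integrable P (\<lambda>\<omega>. - 2 * (grad (x t \<omega>) \<bullet> Y \<omega>))"
      by (intro integrable_mult_right square_integrable_inner square_integrable_iterates Y)
    show "integrable P (\<lambda>\<omega>. - (3 / 2) * (f (x t \<omega>) - fmin) - \<mu> / 2 * (norm (Y \<omega>))\<^sup>2 + 6 * L * (norm (e t \<omega>))\<^sup>2)"
      by (intro Bochner_Integration.integrable_add Bochner_Integration.integrable_diff integrable_mult_right
          integrable_f[OF prob_space_axioms] square_integrableD square_integrable_iterates Y integrable_const)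
  qed (unfold Y_def, rule quasi_convex_inner_bound[OF assms])
  also have "\<dots> = - (3 / 2) * gap t - \<mu> / 2 * vdist xs t + 6 * L * err t"
    using square_integrableD(2)[OF Y(2)]
    by (simp add: square_integrableD square_integrable_iterates integrable_f[OF prob_space_axioms]
        gap_def vdist_def err_def Y_def)
  finally have "vdist xs (Suc t) \<le> vdist xs t
      + \<gamma> * (- (3 / 2) * gap t - \<mu> / 2 * vdist xs t + 6 * L * err t)
      + \<gamma>\<^sup>2 * expectation (\<lambda>\<omega>. (norm (g t \<omega>))\<^sup>2)"
    using \<gamma>_nonneg by (simp add: mult_left_mono)
  also have "\<dots> \<le> vdist xs t
      + \<gamma> * (- (3 / 2) * gap t - \<mu> / 2 * vdist xs t + 6 * L * err t)
      + \<gamma>\<^sup>2 * ((1 + M) * grad_sq t + \<sigma>\<^sup>2)"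
    by (intro add_left_mono mult_left_mono second_moment_gradient_estimate) simp
  finally show ?thesis by (simp add: algebra_simps)
qed

lemma quasi_convex_recursion:
  assumes qc: "quasi_convex \<mu> f grad fmin xs" and \<mu>: "\<mu> \<ge> 0"
    and \<gamma>: "\<gamma> \<le> 1 / (10 * L * (2 / \<delta> + M))"
  shows "vdist xs (Suc t) + err (Suc t)
    \<le> (1 - \<mu> * \<gamma> / 2) * (vdist xs t + err t) - \<gamma> * gap t + 2 * \<gamma>\<^sup>2 * \<sigma>\<^sup>2"
proof -
  \<comment> \<open>Squared gradients are at most \<open>2 * L\<close> times the gap, so an
    admissible step size lets the descent pay for them. This is used for \<open>1 + M\<close> and
    for \<open>2 / \<delta> + M\<close>.\<close>
  have gG: "\<gamma>\<^sup>2 * (K * grad_sq t) \<le> \<gamma> / 5 * gap t" if "\<gamma> * L * K \<le> 1 / 10" "K \<ge> 0" for K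
  proof -
    have "\<gamma>\<^sup>2 * (K * grad_sq t) \<le> \<gamma>\<^sup>2 * (K * (2 * L * gap t))"
      using that grad_sq_le_gap by (intro mult_left_mono) auto
    also have "\<dots> = (\<gamma> * L * K) * (2 * \<gamma> * gap t)" by (simp add: power2_eq_square)
    also have "\<dots> \<le> 1 / 10 * (2 * \<gamma> * gap t)"
      using \<gamma>_nonneg gap_nonneg[of t] that by (intro mult_right_mono) auto
    finally show ?thesis by simp
  qed
  have b: "\<gamma> * L * 2 \<le> \<delta> / 10" using stepsize_bounds(2)[OF \<gamma>] by simp
  have 1: "\<gamma>\<^sup>2 * ((1 + M) * grad_sq t) \<le> \<gamma> / 5 * gap t"
    using stepsize_bounds(3)[OF \<gamma>] M_nonneg by (intro gG) auto
  have 2: "\<gamma>\<^sup>2 * ((2 / \<delta> + M) * grad_sq t) \<le> \<gamma> / 5 * gap t"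
    using stepsize_bounds(1)[OF \<gamma>] M_nonneg \<delta>_pos by (intro gG) auto
  have "\<mu> * \<gamma> / 2 \<le> \<gamma> * L"
    using mult_right_mono[OF quasi_convex_minimizer(3)[OF qc \<mu>] \<gamma>_nonneg] by (simp add: mult_ac)
  \<comment> \<open>Error budget: \<open>\<gamma> * L \<le> \<delta> / 20\<close>, so the coupling
    \<open>6 * L * \<gamma>\<close> and the decay \<open>\<mu> * \<gamma> / 2\<close> together take
    at most \<open>7 * \<delta> / 20\<close> of the available \<open>\<delta> / 2\<close>.\<close>
  then have "6 * L * \<gamma> + (1 - \<delta> / 2) \<le> 1 - \<mu> * \<gamma> / 2"
    using b \<delta>_pos by (simp add: algebra_simps)
  then have 3: "(6 * L * \<gamma> + (1 - \<delta> / 2)) * err t \<le> (1 - \<mu> * \<gamma> / 2) * err t"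
    by (rule mult_right_mono[OF _ err_nonneg])
  have 4: "0 \<le> \<gamma> * gap t" using \<gamma>_nonneg gap_nonneg by simp
  have e1: "\<gamma>\<^sup>2 * ((1 + M) * grad_sq t + \<sigma>\<^sup>2) = \<gamma>\<^sup>2 * ((1 + M) * grad_sq t) + \<gamma>\<^sup>2 * \<sigma>\<^sup>2"
    and e2: "\<gamma>\<^sup>2 * ((2 / \<delta> + M) * grad_sq t + \<sigma>\<^sup>2) = \<gamma>\<^sup>2 * ((2 / \<delta> + M) * grad_sq t) + \<gamma>\<^sup>2 * \<sigma>\<^sup>2"
    by (rule distrib_left)+
  have e3: "(6 * L * \<gamma> + (1 - \<delta> / 2)) * err t = 6 * L * \<gamma> * err t + (1 - \<delta> / 2) * err t"
    by (rule distrib_right)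
  have e4: "(1 - \<mu> * \<gamma> / 2) * (vdist xs t + err t) = (1 - \<mu> * \<gamma> / 2) * vdist xs t + (1 - \<mu> * \<gamma> / 2) * err t"
    by (rule distrib_left)
  \<comment> \<open>Gap budget: of the coefficient \<open>3 / 2\<close> two gradient terms take
    \<open>1 / 5\<close> each, which leaves more than 1. Each of the two recursions contributes one
    \<open>\<gamma>\<^sup>2 * \<sigma>\<^sup>2\<close>.\<close>
  show ?thesis
    using vdist_Suc[OF qc \<mu>, of t] err_Suc[of t] 1 2 3 4 unfolding e1 e2 e3 e4 by simp
qed

section \<open>The non-convex case\<close>

definition "vgap t = expectation (\<lambda>\<omega>. f (x t \<omega> - e t \<omega>) - fmin)"

lemma vgap_nonneg: "0 \<le> vgap t"
  using fmin_le by (simp add: vgap_def)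

lemma vgap_0: "vgap 0 = f x0 - fmin"
proof -
  have "vgap 0 = expectation (\<lambda>\<omega>. f x0 - fmin)"
    unfolding vgap_def by (intro Bochner_Integration.integral_cong) (simp_all add: start)
  then show ?thesis by (simp add: prob_space)
qed

text \<open>Polarization and the Lipschitz bound, with the squared gradient at the virtual point
  discarded.\<close>

lemma grad_virtual_inner_bound:
  "- (grad (y - d) \<bullet> grad y) \<le> - (norm (grad y))\<^sup>2 / 2 + L\<^sup>2 / 2 * (norm d)\<^sup>2"
proof -
  have "(norm (grad (y - d) - grad y))\<^sup>2 \<le> (L * norm d)\<^sup>2"
    using lipschitz[of "y - d" y] by (intro power_mono) auto
  moreover have "(norm (grad (y - d) - grad y))\<^sup>2
      = (norm (grad (y - d)))\<^sup>2 - 2 * (grad (y - d) \<bullet> grad y) + (norm (grad y))\<^sup>2"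
    by (simp add: power2_norm_eq_inner inner_diff_left inner_diff_right inner_commute)
  ultimately have "(norm (grad (y - d)))\<^sup>2 - 2 * (grad (y - d) \<bullet> grad y) + (norm (grad y))\<^sup>2
      \<le> L\<^sup>2 * (norm d)\<^sup>2" by (simp add: power_mult_distrib)
  moreover have "0 \<le> (norm (grad (y - d)))\<^sup>2" by simp
  ultimately show ?thesis by linarith
qed

text \<open>The descent inequality is applied at the virtual point, where the step is exactly
  \<open>- \<gamma>\<close> times \<open>g t\<close>. The gradient there is determined by the past,
  so the noise drops out of the inner product.\<close>

lemma vgap_Suc:
  "vgap (Suc t) \<le> vgap t - \<gamma> / 2 * grad_sq t + \<gamma> * L\<^sup>2 / 2 * err t
    + L / 2 * \<gamma>\<^sup>2 * ((1 + M) * grad_sq t + \<sigma>\<^sup>2)"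
proof -
  define Y where "Y = (\<lambda>\<omega>. grad (x t \<omega> - e t \<omega>))"
  have [measurable]: "x t \<in> borel_measurable (history P S \<xi> s t t)"
    "e t \<in> borel_measurable (history P S \<xi> s t t)" using x_e_adapted by auto
  have Y: "Y \<in> borel_measurable (history P S \<xi> s t t)" "square_integrable P Y"
    unfolding Y_def by (measurable, rule square_integrable_iterates)
  note [simp] = square_integrableD square_integrable_iterates integrable_f[OF prob_space_axioms]
    square_integrable_inner Y
  have "vgap (Suc t) \<le> expectation (\<lambda>\<omega>. (f (x t \<omega> - e t \<omega>) - fmin) - \<gamma> * (Y \<omega> \<bullet> g t \<omega>)
      + L / 2 * \<gamma>\<^sup>2 * (norm (g t \<omega>))\<^sup>2)"
    unfolding vgap_def
  proof (rule integral_mono)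
    fix \<omega> assume "\<omega> \<in> space P"
    then show "f (x (Suc t) \<omega> - e (Suc t) \<omega>) - fmin
        \<le> (f (x t \<omega> - e t \<omega>) - fmin) - \<gamma> * (Y \<omega> \<bullet> g t \<omega>) + L / 2 * \<gamma>\<^sup>2 * (norm (g t \<omega>))\<^sup>2"
      using descent[of "x t \<omega> - e t \<omega>" "(- \<gamma>) *\<^sub>R g t \<omega>"]
      by (simp add: virtual_step Y_def power_mult_distrib)
  qed auto
  also have "\<dots> = vgap t + \<gamma> * - expectation (\<lambda>\<omega>. Y \<omega> \<bullet> grad (x t \<omega>)) + L / 2 * \<gamma>\<^sup>2 * expectation (\<lambda>\<omega>. (norm (g t \<omega>))\<^sup>2)"
    by (simp add: vgap_def expectation_inner_gradient_estimate)
  also have "- expectation (\<lambda>\<omega>. Y \<omega> \<bullet> grad (x t \<omega>)) = expectation (\<lambda>\<omega>. - (Y \<omega> \<bullet> grad (x t \<omega>)))"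
    by simp
  also have "\<dots> \<le> expectation (\<lambda>\<omega>. - (norm (grad (x t \<omega>)))\<^sup>2 / 2 + L\<^sup>2 / 2 * (norm (e t \<omega>))\<^sup>2)"
    by (intro integral_mono) (auto simp: Y_def intro: order.trans[OF grad_virtual_inner_bound])
  also have "\<dots> = - grad_sq t / 2 + L\<^sup>2 / 2 * err t"
    by (simp add: grad_sq_def err_def)
  finally have "vgap (Suc t) \<le> vgap t + \<gamma> * (- grad_sq t / 2 + L\<^sup>2 / 2 * err t)
      + L / 2 * \<gamma>\<^sup>2 * expectation (\<lambda>\<omega>. (norm (g t \<omega>))\<^sup>2)"
    using \<gamma>_nonneg by (simp add: mult_left_mono)
  also have "\<dots> \<le> vgap t + \<gamma> * (- grad_sq t / 2 + L\<^sup>2 / 2 * err t)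
      + L / 2 * \<gamma>\<^sup>2 * ((1 + M) * grad_sq t + \<sigma>\<^sup>2)"
    using L_pos by (intro add_left_mono mult_left_mono second_moment_gradient_estimate) simp
  finally show ?thesis by (simp add: algebra_simps)
qed

text \<open>The weight \<open>\<gamma> * L\<^sup>2 / \<delta>\<close> is the one for which the
  contraction \<open>\<delta> / 2\<close> cancels the term
  \<open>\<gamma> * L\<^sup>2 / 2 * err t\<close> of \<open>vgap_Suc\<close> exactly. The step size
  bound keeps it below \<open>L / 10\<close>.\<close>

lemma nonconvex_recursion:
  assumes \<gamma>: "\<gamma> \<le> 1 / (10 * L * (1 / \<delta> + M))"
  shows "vgap (Suc t) + \<gamma> * L\<^sup>2 / \<delta> * err (Suc t)
    \<le> (vgap t + \<gamma> * L\<^sup>2 / \<delta> * err t) - 2 / 5 * \<gamma> * grad_sq t + L * \<gamma>\<^sup>2 * \<sigma>\<^sup>2"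
proof -
  have b: "\<gamma> * L \<le> \<delta> / 10" using stepsize_bounds(2)[OF \<gamma>] by simp
  have c0: "0 \<le> \<gamma> * L\<^sup>2 / \<delta>" using \<gamma>_nonneg \<delta>_pos by simp
  have 0: "0 \<le> \<gamma> * grad_sq t" using \<gamma>_nonneg grad_sq_nonneg by simp
  have "\<gamma> * L * (1 + M) * (\<gamma> * grad_sq t) \<le> 1 / 10 * (\<gamma> * grad_sq t)"
    using stepsize_bounds(3)[OF \<gamma>] 0 by (intro mult_right_mono) auto
  moreover have "L / 2 * \<gamma>\<^sup>2 * ((1 + M) * grad_sq t) = \<gamma> * L * (1 + M) * (\<gamma> * grad_sq t) / 2"
    by (simp add: power2_eq_square)
  ultimately have 1: "L / 2 * \<gamma>\<^sup>2 * ((1 + M) * grad_sq t) \<le> \<gamma> * grad_sq t / 20" by linarith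
  have c: "\<gamma> * L\<^sup>2 / \<delta> \<le> L / 10"
  proof -
    have "\<gamma> * L / \<delta> \<le> 1 / 10" using b \<delta>_pos by (simp add: field_simps)
    then have "\<gamma> * L / \<delta> * L \<le> 1 / 10 * L" using L_pos by (intro mult_right_mono) auto
    then show ?thesis by (simp add: power2_eq_square)
  qed
  have "\<gamma> * L\<^sup>2 / \<delta> * (\<gamma>\<^sup>2 * ((2 / \<delta> + M) * grad_sq t)) \<le> L / 10 * (\<gamma>\<^sup>2 * ((2 / \<delta> + M) * grad_sq t))"
    using c M_nonneg \<delta>_pos grad_sq_nonneg[of t] by (intro mult_right_mono) auto
  \<comment> \<open>The step size cap of this case contains \<open>1 / \<delta> + M\<close>, so the
    coefficient of the error recursion is replaced by twice that quantity.\<close>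
  also have "\<dots> \<le> L / 10 * (\<gamma>\<^sup>2 * (2 * (1 / \<delta> + M) * grad_sq t))"
    using L_pos M_nonneg grad_sq_nonneg[of t] by (intro mult_left_mono mult_right_mono) auto
  also have "\<dots> = 1 / 5 * (\<gamma> * L * (1 / \<delta> + M)) * (\<gamma> * grad_sq t)"
    by (simp add: power2_eq_square)
  also have "\<dots> \<le> 1 / 5 * (1 / 10) * (\<gamma> * grad_sq t)"
    using stepsize_bounds(1)[OF \<gamma>] 0 by (intro mult_right_mono mult_left_mono) auto
  finally have 2: "\<gamma> * L\<^sup>2 / \<delta> * (\<gamma>\<^sup>2 * ((2 / \<delta> + M) * grad_sq t)) \<le> \<gamma> * grad_sq t / 50" by simp
  have 3: "\<gamma> * L\<^sup>2 / \<delta> * (\<gamma>\<^sup>2 * \<sigma>\<^sup>2) \<le> L / 10 * (\<gamma>\<^sup>2 * \<sigma>\<^sup>2)"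
    using c by (rule mult_right_mono) simp
  have "\<gamma> * L\<^sup>2 / \<delta> * err (Suc t)
      \<le> \<gamma> * L\<^sup>2 / \<delta> * ((1 - \<delta> / 2) * err t + \<gamma>\<^sup>2 * ((2 / \<delta> + M) * grad_sq t + \<sigma>\<^sup>2))"
    using err_Suc c0 by (rule mult_left_mono)
  also have "\<dots> = \<gamma> * L\<^sup>2 / \<delta> * err t - \<gamma> * L\<^sup>2 / 2 * err t
      + \<gamma> * L\<^sup>2 / \<delta> * (\<gamma>\<^sup>2 * ((2 / \<delta> + M) * grad_sq t)) + \<gamma> * L\<^sup>2 / \<delta> * (\<gamma>\<^sup>2 * \<sigma>\<^sup>2)"
    using \<delta>_pos by (simp add: divide_simps) (simp add: algebra_simps)
  finally have 4: "\<gamma> * L\<^sup>2 / \<delta> * err (Suc t) \<le> \<gamma> * L\<^sup>2 / \<delta> * err t - \<gamma> * L\<^sup>2 / 2 * err t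
      + \<gamma> * grad_sq t / 50 + L / 10 * (\<gamma>\<^sup>2 * \<sigma>\<^sup>2)"
    using 2 3 by linarith
  have "L / 2 * \<gamma>\<^sup>2 * ((1 + M) * grad_sq t + \<sigma>\<^sup>2)
      = L / 2 * \<gamma>\<^sup>2 * ((1 + M) * grad_sq t) + L * (\<gamma>\<^sup>2 * \<sigma>\<^sup>2) / 2" by (simp add: distrib_left)
  moreover have "vgap (Suc t) \<le> vgap t - \<gamma> * grad_sq t / 2 + \<gamma> * L\<^sup>2 / 2 * err t
      + L / 2 * \<gamma>\<^sup>2 * ((1 + M) * grad_sq t + \<sigma>\<^sup>2)"
    using vgap_Suc[of t] by simp
  ultimately have 5: "vgap (Suc t) \<le> vgap t - \<gamma> * grad_sq t / 2 + \<gamma> * L\<^sup>2 / 2 * err t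
      + (\<gamma> * grad_sq t / 20 + L * (\<gamma>\<^sup>2 * \<sigma>\<^sup>2) / 2)"
    using 1 by linarith
  have 6: "0 \<le> L * (\<gamma>\<^sup>2 * \<sigma>\<^sup>2)" using L_pos by simp
  \<comment> \<open>Budget: \<open>1 / 2 - 1 / 20 - 1 / 50\<close> exceeds \<open>2 / 5\<close>, and
    the noise coefficients \<open>1 / 2\<close> and \<open>1 / 10\<close> sum to less than
    1.\<close>
  have "vgap (Suc t) + \<gamma> * L\<^sup>2 / \<delta> * err (Suc t)
      \<le> (vgap t + \<gamma> * L\<^sup>2 / \<delta> * err t) - 2 / 5 * (\<gamma> * grad_sq t) + L * (\<gamma>\<^sup>2 * \<sigma>\<^sup>2)"
    using 0 4 5 6 by linarith
  then show ?thesis by (simp add: mult.assoc)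
qed

text \<open>Rule B yields the step size \<open>0\<close> when the starting point is already optimal.\<close>

lemma zero_stepsize:
  assumes "\<gamma> = 0" "f x0 = fmin"
  shows "gap t = 0" "grad_sq t = 0"
proof -
  \<comment> \<open>Without a gradient contribution the error recursion has no source term. The
    error vanishes only in mean square, since \<open>C\<close> may move 0 on a null set of
    seeds.\<close>
  have err: "err t = 0" for t
  proof (induction t)
    case (Suc t)
    then show ?case using err_Suc[of t] err_nonneg[of "Suc t"] assms by simp
  qed (rule err_0)
  have "x t \<omega> - e t \<omega> = x0" if "\<omega> \<in> space P" for t \<omega>
    by (induction t) (use that assms in \<open>simp_all add: start virtual_step\<close>)
  then have x: "x t \<omega> = x0 + e t \<omega>" if "\<omega> \<in> space P" for \<omega>
    using that by (metis add.commute diff_add_cancel)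
  have g0: "grad x0 = 0" using norm_grad_sq_le[of x0] assms by simp
  \<comment> \<open>The quadratic bound at the critical point \<open>x0\<close> turns the vanishing
    mean square error into a vanishing gap, without an almost sure argument.\<close>
  have "gap t \<le> expectation (\<lambda>\<omega>. L / 2 * (norm (e t \<omega>))\<^sup>2)"
    unfolding gap_def
  proof (rule integral_mono)
    fix \<omega> assume "\<omega> \<in> space P"
    then show "f (x t \<omega>) - fmin \<le> L / 2 * (norm (e t \<omega>))\<^sup>2"
      using descent[of x0 "e t \<omega>"] assms g0 by (simp add: x)
  qed (auto intro!: integrable_f[OF prob_space_axioms] square_integrable_iterates square_integrableD)
  also have "\<dots> = 0" using err[of t] by (simp add: err_def)
  finally show "gap t = 0" using gap_nonneg[of t] by simp
  then show "grad_sq t = 0" using grad_sq_le_gap[of t] grad_sq_nonneg[of t] by simp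
qed

section \<open>Bounds at the random output index\<close>

lemma integrable_gap: "integrable P (\<lambda>\<omega>. f (x t \<omega>) - fmin)"
  using integrable_f[OF prob_space_axioms square_integrable_iterates(1)] by simp

lemma integrable_grad_sq: "integrable P (\<lambda>\<omega>. (norm (grad (x t \<omega>)))\<^sup>2)"
  by (rule square_integrableD(2)[OF square_integrable_iterates(5)])

lemma expectation_out_geometric:
  assumes qc: "quasi_convex \<mu> f grad fmin xs" and \<mu>: "\<mu> > 0"
    and \<gamma>: "0 < \<gamma>" "\<gamma> \<le> 1 / (10 * L * (2 / \<delta> + M))" and T: "T \<ge> 1"
    and B: "2 * ((norm (x0 - xs))\<^sup>2 / \<gamma> * exp (- (\<mu> / 2) * \<gamma> * T) + \<sigma>\<^sup>2 * \<gamma>) \<le> B"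
  shows "expectation_out_le (geometric_index (1 - \<mu> * \<gamma> / 2) T) P (\<lambda>t \<omega>. f (x t \<omega>) - fmin) B"
proof -
  define q where "q = 1 - \<mu> * \<gamma> / 2"
  have "\<mu> * \<gamma> / 2 \<le> \<gamma> * L"
    using mult_right_mono[OF quasi_convex_minimizer(3)[OF qc] \<gamma>_nonneg] \<mu> by (simp add: mult_ac)
  moreover have "\<gamma> * L * 2 \<le> \<delta> / 10" using stepsize_bounds(2)[OF \<gamma>(2)] by simp
  \<comment> \<open>The two bounds give \<open>\<mu> * \<gamma> / 2 \<le> \<delta> / 20\<close>,
    hence \<open>q \<ge> 19 / 20\<close>.\<close>
  ultimately have q: "q > 0" using \<delta>_le_1 by (simp add: q_def)
  have "(\<Sum>t<T. 1 / q ^ t / (\<Sum>i<T. 1 / q ^ i) * gap t)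
      \<le> q ^ T * (vdist xs 0 + err 0) / \<gamma> + 2 * \<gamma>\<^sup>2 * \<sigma>\<^sup>2 / \<gamma>"
    using quasi_convex_recursion[OF qc _ \<gamma>(2)] \<mu> vdist_nonneg err_nonneg \<gamma>(1) T q
    by (intro weighted_average_bound[where \<Phi> = "\<lambda>t. vdist xs t + err t"]) (auto simp: q_def)
  also have "\<dots> = (norm (x0 - xs))\<^sup>2 / \<gamma> * q ^ T + 2 * \<sigma>\<^sup>2 * \<gamma>"
    using \<gamma>(1) by (simp add: vdist_0 err_0 power2_eq_square)
  also have "\<dots> \<le> (norm (x0 - xs))\<^sup>2 / \<gamma> * exp (- (\<mu> / 2) * \<gamma> * T) + 2 * \<sigma>\<^sup>2 * \<gamma>"
  proof (intro add_right_mono mult_left_mono)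
    have "q ^ T \<le> exp (- (\<mu> / 2) * \<gamma>) ^ T"
      using q exp_ge_add_one_self[of "- (\<mu> / 2) * \<gamma>"] by (intro power_mono) (auto simp: q_def)
    also have "\<dots> = exp (- (\<mu> / 2) * \<gamma> * T)" by (simp flip: exp_of_nat_mult add: mult_ac)
    finally show "q ^ T \<le> exp (- (\<mu> / 2) * \<gamma> * T)" .
  qed (use \<gamma>(1) in auto)
  \<comment> \<open>The first term is doubled along with the noise term, so that the bracket becomes
    the expression that rule A makes small.\<close>
  also have "\<dots> \<le> 2 * ((norm (x0 - xs))\<^sup>2 / \<gamma> * exp (- (\<mu> / 2) * \<gamma> * T) + \<sigma>\<^sup>2 * \<gamma>)"
  proof -
    have "0 \<le> (norm (x0 - xs))\<^sup>2 / \<gamma> * exp (- (\<mu> / 2) * \<gamma> * T)" using \<gamma>(1) by simp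
    then show ?thesis unfolding distrib_left mult.assoc by linarith
  qed
  also note B
  finally show ?thesis
    using q T unfolding q_def[symmetric]
    by (intro expectation_out_leI[OF prob_space_axioms integrable_gap, where T = T])
      (auto simp: pmf_geometric_index gap_def set_pmf_eq split: if_splits)
qed

lemma expectation_out_uniformI:
  assumes "T \<ge> 1" "\<And>t. integrable P (h t)" "(\<Sum>t<T. 1 / T * expectation (h t)) \<le> B"
  shows "expectation_out_le (uniform_index T) P h B"
proof -
  have "set_pmf (uniform_index T) \<subseteq> {..<T}" using assms(1) by (subst set_pmf_of_set) (auto simp: lessThan_empty_iff)
  then show ?thesis
    using assms
    by (intro expectation_out_leI[OF prob_space_axioms, where T = T]) (auto simp: pmf_uniform_index)
qed

lemma expectation_out_uniform_quasi_convex: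
  assumes qc: "quasi_convex 0 f grad fmin xs" and \<gamma>: "\<gamma> \<le> 1 / (10 * L * (2 / \<delta> + M))" and T: "T \<ge> 1"
    and 0: "\<gamma> = 0 \<Longrightarrow> x0 = xs" "0 \<le> B"
    and B: "\<gamma> > 0 \<Longrightarrow> 2 * ((norm (x0 - xs))\<^sup>2 / (\<gamma> * T) + \<sigma>\<^sup>2 * \<gamma>) \<le> B"
  shows "expectation_out_le (uniform_index T) P (\<lambda>t \<omega>. f (x t \<omega>) - fmin) B"
proof (rule expectation_out_uniformI[OF T integrable_gap], fold gap_def)
  show "(\<Sum>t<T. 1 / T * gap t) \<le> B"
  \<comment> \<open>With a zero step size the averaging bound would divide by 0; but then the start
    is a minimizer, every gap vanishes, and only \<open>0 \<le> B\<close> is left.\<close>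
  proof (cases "\<gamma> = 0")
    case True
    then show ?thesis
      using zero_stepsize(1) quasi_convex_minimizer(1)[OF qc] 0 by simp
  next
    case False
    then have g: "\<gamma> > 0" using \<gamma>_nonneg by simp
    have "(\<Sum>t<T. 1 / T * gap t) \<le> (vdist xs 0 + err 0) / (\<gamma> * T) + 2 * \<gamma>\<^sup>2 * \<sigma>\<^sup>2 / \<gamma>"
      using quasi_convex_recursion[OF qc _ \<gamma>] vdist_nonneg err_nonneg g T
      by (intro uniform_average_bound[where \<Phi> = "\<lambda>t. vdist xs t + err t"]) auto
    also have "\<dots> = (norm (x0 - xs))\<^sup>2 / (\<gamma> * T) + 2 * \<sigma>\<^sup>2 * \<gamma>"
      using g by (simp add: vdist_0 err_0 power2_eq_square)
    also have "\<dots> \<le> 2 * ((norm (x0 - xs))\<^sup>2 / (\<gamma> * T) + \<sigma>\<^sup>2 * \<gamma>)"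
    proof -
      have "0 \<le> (norm (x0 - xs))\<^sup>2 / (\<gamma> * T)" using g by simp
      then show ?thesis unfolding distrib_left mult.assoc[of 2] by linarith
    qed
    finally show ?thesis using B[OF g] by simp
  qed
qed

text \<open>The factor \<open>5 / 2\<close> is the inverse of the descent coefficient
  \<open>2 / 5\<close>. The error part of the Lyapunov function starts at 0.\<close>

lemma expectation_out_uniform_nonconvex:
  assumes \<gamma>: "\<gamma> \<le> 1 / (10 * L * (1 / \<delta> + M))" and T: "T \<ge> 1"
    and 0: "\<gamma> = 0 \<Longrightarrow> f x0 - fmin = 0" "0 \<le> B"
    and B: "\<gamma> > 0 \<Longrightarrow> 5 / 2 * ((f x0 - fmin) / (\<gamma> * T) + L * \<sigma>\<^sup>2 * \<gamma>) \<le> B"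
  shows "expectation_out_le (uniform_index T) P (\<lambda>t \<omega>. (norm (grad (x t \<omega>)))\<^sup>2) B"
proof (rule expectation_out_uniformI[OF T integrable_grad_sq], fold grad_sq_def)
  show "(\<Sum>t<T. 1 / T * grad_sq t) \<le> B"
  proof (cases "\<gamma> = 0")
    case True
    then show ?thesis using zero_stepsize(2) 0 by simp
  next
    case False
    then have g: "\<gamma> > 0" using \<gamma>_nonneg by simp
    have "(\<Sum>t<T. 1 / T * grad_sq t)
        \<le> (vgap 0 + \<gamma> * L\<^sup>2 / \<delta> * err 0) / (2 / 5 * \<gamma> * T) + L * \<gamma>\<^sup>2 * \<sigma>\<^sup>2 / (2 / 5 * \<gamma>)"
      using nonconvex_recursion[OF \<gamma>] vgap_nonneg err_nonneg g T \<delta>_pos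
      by (intro uniform_average_bound[where \<Phi> = "\<lambda>t. vgap t + \<gamma> * L\<^sup>2 / \<delta> * err t"]) auto
    also have "\<dots> = 5 / 2 * ((f x0 - fmin) / (\<gamma> * T) + L * \<sigma>\<^sup>2 * \<gamma>)"
      using g by (simp add: vgap_0 err_0 power2_eq_square algebra_simps)
    finally show ?thesis using B[OF g] by simp
  qed
qed

end

theorem theorem22:
  fixes f :: "'a::euclidean_space \<Rightarrow> real" and grad :: "'a \<Rightarrow> 'a"
    and fmin L M \<sigma> \<delta> :: real
    and S :: "'s measure" and C :: "'a \<Rightarrow> 's \<Rightarrow> 'a"
    and x0 :: 'a and T :: nat
  assumes gradient: "\<forall>x. GDERIV f x :> grad x"
    and minimum: "fmin \<in> range f" "\<forall>x. fmin \<le> f x"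
    and smooth: "L > 0" "\<forall>x y. norm (grad x - grad y) \<le> L * norm (x - y)"
    and noise: "M \<ge> 0" "\<sigma> \<ge> 0"
    and compressor: "\<delta> > 0" "approx_compressor \<delta> S C"
    and T: "T \<ge> 1"
  shows
    "(\<forall>\<mu> xs. \<mu> > 0 \<and> quasi_convex \<mu> f grad fmin xs \<longrightarrow>
       (\<exists>\<gamma>. \<gamma> = stepsize_A (\<mu> / 2) (\<sigma>\<^sup>2) ((norm (x0 - xs))\<^sup>2) (10 * L * (2 / \<delta> + M)) T \<and>
            0 < \<gamma> \<and> \<gamma> \<le> 1 / (10 * L * (2 / \<delta> + M)) \<and>
            (\<forall>(P :: 'w measure) \<xi> s x e g v. ec_sgd_run M \<sigma> grad S C x0 \<gamma> P \<xi> s x e g v \<longrightarrow>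
               expectation_out_le (geometric_index (1 - \<mu> * \<gamma> / 2) T) P
                 (\<lambda>t \<omega>. f (x t \<omega>) - fmin)
                 (O_const * tuning_log (\<mu> / 2) (\<sigma>\<^sup>2) ((norm (x0 - xs))\<^sup>2) T *
                   (L * (1 / \<delta> + M) * (norm (x0 - xs))\<^sup>2
                        * exp (- (\<mu> / 2) * T / (10 * L * (2 / \<delta> + M)))
                    + \<sigma>\<^sup>2 / (\<mu> * T))))))
     \<and>
     (\<forall>xs. quasi_convex 0 f grad fmin xs \<longrightarrow>
       (\<exists>\<gamma>. \<gamma> = stepsize_B (\<sigma>\<^sup>2) ((norm (x0 - xs))\<^sup>2) (10 * L * (2 / \<delta> + M)) T \<and>
            0 \<le> \<gamma> \<and> \<gamma> \<le> 1 / (10 * L * (2 / \<delta> + M)) \<and>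
            (\<forall>(P :: 'w measure) \<xi> s x e g v. ec_sgd_run M \<sigma> grad S C x0 \<gamma> P \<xi> s x e g v \<longrightarrow>
               expectation_out_le (uniform_index T) P
                 (\<lambda>t \<omega>. f (x t \<omega>) - fmin)
                 (O_const *
                   (L * (1 / \<delta> + M) * (norm (x0 - xs))\<^sup>2 / T
                    + \<sigma> * norm (x0 - xs) / sqrt T)))))
     \<and>
       (\<exists>\<gamma>. \<gamma> = stepsize_B (L * \<sigma>\<^sup>2) (f x0 - fmin) (10 * L * (1 / \<delta> + M)) T \<and>
            0 \<le> \<gamma> \<and> \<gamma> \<le> 1 / (10 * L * (1 / \<delta> + M)) \<and>
            (\<forall>(P :: 'w measure) \<xi> s x e g v. ec_sgd_run M \<sigma> grad S C x0 \<gamma> P \<xi> s x e g v \<longrightarrow>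
               expectation_out_le (uniform_index T) P
                 (\<lambda>t \<omega>. (norm (grad (x t \<omega>)))\<^sup>2)
                 (O_const *
                   (L * (1 / \<delta> + M) * (f x0 - fmin) / T
                    + \<sigma> * sqrt (L * (f x0 - fmin) / T)))))"
proof (intro conjI allI impI)
  interpret smooth_function f grad fmin L
    using gradient minimum(2) smooth by unfold_locales auto
  define D where "D = L * (1 / \<delta> + M)"
  have K2: "2 / \<delta> + M > 0" and K1: "1 / \<delta> + M > 0"
    using compressor(1) noise(1) by (auto intro: add_pos_nonneg)
  have D2: "0 < 10 * L * (2 / \<delta> + M)" and D1: "0 < 10 * L * (1 / \<delta> + M)"
    using K1 K2 smooth(1) by auto
  \<comment> \<open>The claimed bounds contain \<open>1 / \<delta> + M\<close>, the step size cap of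
    the quasi-convex cases \<open>2 / \<delta> + M\<close>; passing from one to the other costs a
    factor 2.\<close>
  have "L * (2 / \<delta> + M) \<le> L * (2 * (1 / \<delta> + M))"
    using smooth(1) noise(1) by (intro mult_left_mono) auto
  moreover have "L * (2 * (1 / \<delta> + M)) = 2 * D" by (simp only: D_def mult.left_commute)
  moreover have "10 * L * (2 / \<delta> + M) = 10 * (L * (2 / \<delta> + M))" by (rule mult.assoc)
  ultimately have D_le: "10 * L * (2 / \<delta> + M) \<le> 20 * D" by linarith
  have D0: "D > 0" using K1 smooth(1) by (simp add: D_def)
  have T0: "real T > 0" using T by simp
  \<comment> \<open>The step size is fixed before the probability space, so the locale is entered
    anew for each run.\<close>
  have run: "error_compensated_sgd f grad fmin L M \<sigma> \<delta> S C x0 \<gamma> P \<xi> s x e g v"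
    if "ec_sgd_run M \<sigma> grad S C x0 \<gamma> P \<xi> s x e g v" "\<gamma> \<ge> 0"
    for \<gamma> and P :: "'w measure" and \<xi> s x e g v
    using that noise compressor by unfold_locales auto

  show "\<exists>\<gamma>. \<gamma> = stepsize_A (\<mu> / 2) (\<sigma>\<^sup>2) ((norm (x0 - xs))\<^sup>2) (10 * L * (2 / \<delta> + M)) T \<and>
            0 < \<gamma> \<and> \<gamma> \<le> 1 / (10 * L * (2 / \<delta> + M)) \<and>
            (\<forall>(P :: 'w measure) \<xi> s x e g v. ec_sgd_run M \<sigma> grad S C x0 \<gamma> P \<xi> s x e g v \<longrightarrow>
               expectation_out_le (geometric_index (1 - \<mu> * \<gamma> / 2) T) P
                 (\<lambda>t \<omega>. f (x t \<omega>) - fmin)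
                 (O_const * tuning_log (\<mu> / 2) (\<sigma>\<^sup>2) ((norm (x0 - xs))\<^sup>2) T *
                   (L * (1 / \<delta> + M) * (norm (x0 - xs))\<^sup>2
                        * exp (- (\<mu> / 2) * T / (10 * L * (2 / \<delta> + M)))
                    + \<sigma>\<^sup>2 / (\<mu> * T))))"
    if "\<mu> > 0 \<and> quasi_convex \<mu> f grad fmin xs" for \<mu> xs
  proof -
    define r0 where "r0 = (norm (x0 - xs))\<^sup>2"
    define \<gamma> where "\<gamma> = stepsize_A (\<mu> / 2) (\<sigma>\<^sup>2) r0 (10 * L * (2 / \<delta> + M)) T"
    define l where "l = tuning_log (\<mu> / 2) (\<sigma>\<^sup>2) r0 T"
    define E where "E = exp (- (\<mu> / 2) * T / (10 * L * (2 / \<delta> + M)))"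
    have r0: "r0 \<ge> 0" by (simp add: r0_def)
    have \<mu>: "\<mu> > 0" "quasi_convex \<mu> f grad fmin xs" using that by auto
    have tuned: "0 < \<gamma>" "\<gamma> \<le> 1 / (10 * L * (2 / \<delta> + M))"
      "r0 / \<gamma> * exp (- (\<mu> / 2) * \<gamma> * T) + \<sigma>\<^sup>2 * \<gamma>
        \<le> 5 * l * (10 * L * (2 / \<delta> + M) * r0 * E + \<sigma>\<^sup>2 / (\<mu> / 2 * T))"
      unfolding \<gamma>_def l_def E_def
      using \<mu> r0 D2 T by (intro stepsize_A_tuned; simp)+
    have "l \<ge> 0" by (simp add: l_def tuning_log_def)
    \<comment> \<open>The second summand is rounded up from 2 to 20, so that one common constant
      \<open>5 * 20 = 100\<close> can be factored out. Doubling gives 200, which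
      \<open>O_const\<close> exceeds.\<close>
    have "r0 / \<gamma> * exp (- (\<mu> / 2) * \<gamma> * T) + \<sigma>\<^sup>2 * \<gamma> \<le> 5 * l * (20 * D * r0 * E + 20 * (\<sigma>\<^sup>2 / (\<mu> * T)))"
    proof (rule order.trans[OF tuned(3)], intro mult_left_mono add_mono mult_right_mono D_le)
      show "\<sigma>\<^sup>2 / (\<mu> / 2 * T) \<le> 20 * (\<sigma>\<^sup>2 / (\<mu> * T))"
        using \<mu>(1) T0 by (simp add: field_simps)
    qed (use \<open>l \<ge> 0\<close> r0 in \<open>auto simp: E_def\<close>)
    also have "\<dots> = 100 * (l * (D * r0 * E + \<sigma>\<^sup>2 / (\<mu> * T)))" by (simp add: algebra_simps)
    finally have le: "r0 / \<gamma> * exp (- (\<mu> / 2) * \<gamma> * T) + \<sigma>\<^sup>2 * \<gamma>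
        \<le> 100 * (l * (D * r0 * E + \<sigma>\<^sup>2 / (\<mu> * T)))" .
    have "0 \<le> l * (D * r0 * E + \<sigma>\<^sup>2 / (\<mu> * T))"
      using \<open>l \<ge> 0\<close> r0 D0 \<mu>(1) by (simp add: E_def)
    moreover have "2 * a \<le> 1000 * b" if "a \<le> 100 * b" "0 \<le> b" for a b :: real
      using that by linarith
    ultimately have "2 * (r0 / \<gamma> * exp (- (\<mu> / 2) * \<gamma> * T) + \<sigma>\<^sup>2 * \<gamma>)
        \<le> 1000 * (l * (D * r0 * E + \<sigma>\<^sup>2 / (\<mu> * T)))"
      using le by blast
    then have B: "2 * (r0 / \<gamma> * exp (- (\<mu> / 2) * \<gamma> * T) + \<sigma>\<^sup>2 * \<gamma>)
        \<le> O_const * l * (D * r0 * E + \<sigma>\<^sup>2 / (\<mu> * T))" by (simp add: O_const_def mult.assoc)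
    show ?thesis
      unfolding r0_def[symmetric] E_def[symmetric] l_def[symmetric] D_def[symmetric] \<gamma>_def[symmetric]
    proof (intro exI[of _ \<gamma>] conjI allI impI refl tuned)
      fix P :: "'w measure" and \<xi> s x e g v
      assume "ec_sgd_run M \<sigma> grad S C x0 \<gamma> P \<xi> s x e g v"
      then interpret error_compensated_sgd f grad fmin L M \<sigma> \<delta> S C x0 \<gamma> P \<xi> s x e g v
        using tuned(1) by (intro run) auto
      show "expectation_out_le (geometric_index (1 - \<mu> * \<gamma> / 2) T) P (\<lambda>t \<omega>. f (x t \<omega>) - fmin)
          (O_const * l * (D * r0 * E + \<sigma>\<^sup>2 / (\<mu> * T)))"
        using expectation_out_geometric[OF \<mu>(2,1) tuned(1,2) T] B by (simp add: r0_def)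
    qed
  qed

  show "\<exists>\<gamma>. \<gamma> = stepsize_B (\<sigma>\<^sup>2) ((norm (x0 - xs))\<^sup>2) (10 * L * (2 / \<delta> + M)) T \<and>
            0 \<le> \<gamma> \<and> \<gamma> \<le> 1 / (10 * L * (2 / \<delta> + M)) \<and>
            (\<forall>(P :: 'w measure) \<xi> s x e g v. ec_sgd_run M \<sigma> grad S C x0 \<gamma> P \<xi> s x e g v \<longrightarrow>
               expectation_out_le (uniform_index T) P
                 (\<lambda>t \<omega>. f (x t \<omega>) - fmin)
                 (O_const *
                   (L * (1 / \<delta> + M) * (norm (x0 - xs))\<^sup>2 / T
                    + \<sigma> * norm (x0 - xs) / sqrt T)))"
    if qc: "quasi_convex 0 f grad fmin xs" for xs
  proof -
    define r where "r = norm (x0 - xs)"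
    define \<gamma> where "\<gamma> = stepsize_B (\<sigma>\<^sup>2) (r\<^sup>2) (10 * L * (2 / \<delta> + M)) T"
    define B where "B = O_const * (D * r\<^sup>2 / T + \<sigma> * r / sqrt T)"
    have \<gamma>: "0 \<le> \<gamma>" "\<gamma> \<le> 1 / (10 * L * (2 / \<delta> + M))" "\<gamma> = 0 \<Longrightarrow> r\<^sup>2 = 0"
      "\<gamma> > 0 \<Longrightarrow> r\<^sup>2 / (\<gamma> * T) + \<sigma>\<^sup>2 * \<gamma> \<le> 10 * L * (2 / \<delta> + M) * r\<^sup>2 / T + 2 * sqrt (\<sigma>\<^sup>2 * r\<^sup>2 / T)"
      using stepsize_B_tuned[of "\<sigma>\<^sup>2" "r\<^sup>2", OF _ _ D2 T] unfolding \<gamma>_def by auto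
    have pos: "0 \<le> D * r\<^sup>2 / T" "0 \<le> \<sigma> * r / sqrt T" using D0 noise(2) by (simp_all add: r_def)
    have "10 * L * (2 / \<delta> + M) * r\<^sup>2 / T \<le> 20 * D * r\<^sup>2 / T"
      by (intro divide_right_mono mult_right_mono D_le) auto
    moreover have "sqrt (\<sigma>\<^sup>2 * r\<^sup>2 / T) = \<sigma> * r / sqrt T"
      using noise(2) by (simp add: real_sqrt_mult real_sqrt_divide r_def)
    ultimately have bound: "2 * (r\<^sup>2 / (\<gamma> * T) + \<sigma>\<^sup>2 * \<gamma>) \<le> B" if "\<gamma> > 0"
      using \<gamma>(4)[OF that] pos by (simp add: B_def O_const_def)
    have "0 \<le> B" using pos by (simp add: B_def O_const_def)
    show ?thesis
      unfolding r_def[symmetric] D_def[symmetric] \<gamma>_def[symmetric] B_def[symmetric]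
    proof (intro exI[of _ \<gamma>] conjI allI impI refl \<gamma>)
      fix P :: "'w measure" and \<xi> s x e g v
      assume "ec_sgd_run M \<sigma> grad S C x0 \<gamma> P \<xi> s x e g v"
      then interpret error_compensated_sgd f grad fmin L M \<sigma> \<delta> S C x0 \<gamma> P \<xi> s x e g v
        using \<gamma>(1) by (rule run)
      show "expectation_out_le (uniform_index T) P (\<lambda>t \<omega>. f (x t \<omega>) - fmin) B"
        using \<gamma>(3) bound \<open>0 \<le> B\<close>
        by (intro expectation_out_uniform_quasi_convex[OF qc \<gamma>(2) T]) (simp_all add: r_def)
    qed
  qed

  show "\<exists>\<gamma>. \<gamma> = stepsize_B (L * \<sigma>\<^sup>2) (f x0 - fmin) (10 * L * (1 / \<delta> + M)) T \<and>
            0 \<le> \<gamma> \<and> \<gamma> \<le> 1 / (10 * L * (1 / \<delta> + M)) \<and>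
            (\<forall>(P :: 'w measure) \<xi> s x e g v. ec_sgd_run M \<sigma> grad S C x0 \<gamma> P \<xi> s x e g v \<longrightarrow>
               expectation_out_le (uniform_index T) P
                 (\<lambda>t \<omega>. (norm (grad (x t \<omega>)))\<^sup>2)
                 (O_const *
                   (L * (1 / \<delta> + M) * (f x0 - fmin) / T
                    + \<sigma> * sqrt (L * (f x0 - fmin) / T))))"
  proof -
    define r0 where "r0 = f x0 - fmin"
    define \<gamma> where "\<gamma> = stepsize_B (L * \<sigma>\<^sup>2) r0 (10 * L * (1 / \<delta> + M)) T"
    define B where "B = O_const * (D * r0 / T + \<sigma> * sqrt (L * r0 / T))"
    have r0: "r0 \<ge> 0" using fmin_le by (simp add: r0_def)
    have \<gamma>: "0 \<le> \<gamma>" "\<gamma> \<le> 1 / (10 * L * (1 / \<delta> + M))" "\<gamma> = 0 \<Longrightarrow> r0 = 0"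
      "\<gamma> > 0 \<Longrightarrow> r0 / (\<gamma> * T) + L * \<sigma>\<^sup>2 * \<gamma> \<le> 10 * L * (1 / \<delta> + M) * r0 / T + 2 * sqrt (L * \<sigma>\<^sup>2 * r0 / T)"
      using stepsize_B_tuned[of "L * \<sigma>\<^sup>2" r0, OF _ r0 D1 T] smooth(1) unfolding \<gamma>_def by auto
    have pos: "0 \<le> D * r0 / T" "0 \<le> \<sigma> * sqrt (L * r0 / T)" using D0 noise(2) smooth(1) r0 by simp_all
    have "L * \<sigma>\<^sup>2 * r0 / T = \<sigma>\<^sup>2 * (L * r0 / T)" by simp
    then have "sqrt (L * \<sigma>\<^sup>2 * r0 / T) = \<sigma> * sqrt (L * r0 / T)"
      using noise(2) by (simp only: real_sqrt_mult real_sqrt_abs abs_of_nonneg)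
    moreover have "10 * L * (1 / \<delta> + M) * r0 / T = 10 * (D * r0 / T)" by (simp add: D_def)
    ultimately have "r0 / (\<gamma> * T) + L * \<sigma>\<^sup>2 * \<gamma> \<le> 10 * (D * r0 / T) + 2 * (\<sigma> * sqrt (L * r0 / T))"
      if "\<gamma> > 0" using \<gamma>(4)[OF that] by (simp only:)
    \<comment> \<open>The actual constants are 25 and 5. Stated for variables, so that the nonlinear
      terms stay opaque to the arithmetic.\<close>
    moreover have "5 / 2 * a \<le> 1000 * (b + c)" if "a \<le> 10 * b + 2 * c" "0 \<le> b" "0 \<le> c" for a b c :: real
      using that by simp
    ultimately have bound: "5 / 2 * (r0 / (\<gamma> * T) + L * \<sigma>\<^sup>2 * \<gamma>) \<le> B" if "\<gamma> > 0"
      using that pos unfolding B_def O_const_def by blast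
    have "0 \<le> B" using pos by (simp add: B_def O_const_def)
    show ?thesis
      unfolding r0_def[symmetric] D_def[symmetric] \<gamma>_def[symmetric] B_def[symmetric]
    proof (intro exI[of _ \<gamma>] conjI allI impI refl \<gamma>)
      fix P :: "'w measure" and \<xi> s x e g v
      assume "ec_sgd_run M \<sigma> grad S C x0 \<gamma> P \<xi> s x e g v"
      then interpret error_compensated_sgd f grad fmin L M \<sigma> \<delta> S C x0 \<gamma> P \<xi> s x e g v
        using \<gamma>(1) by (rule run)
      show "expectation_out_le (uniform_index T) P (\<lambda>t \<omega>. (norm (grad (x t \<omega>)))\<^sup>2) B"
        using \<gamma>(3) bound \<open>0 \<le> B\<close>
        by (intro expectation_out_uniform_nonconvex[OF \<gamma>(2) T]) (simp_all add: r0_def)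
    qed
  qed
qed

end
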